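(* Let $n>m\ge1$ be integers. For matrices $A$ randomly chosen from the uniform distribution in $(S^m)^n$, $$\mathbf E(\ln\mathscr C(A))\le 2\ln(m+1)+3.31.$$
   Context: $S^m$ is the unit sphere in $\mathbb R^{m+1}$. A point $A=(a_1,\dots,a_n)\in(S^m)^n$ is identified with the matrix with rows $a_1,\dots,a_n$. For $p\in S^m$ and $\alpha\in[0,\pi]$, $\mathsf{cap}(p,\alpha)=\{x\in S^m\mid\langle p,x\rangle\ge\cos\alpha\}$. A smallest including cap of $A$ is a spherical cap of minimal angular radius containing $a_1,\dots,a_n$; this minimal radius, uniquely determined by $A$, is denoted $\rho(A)$. The GCC condition number is $\mathscr C(A):=1/|\cos\rho(A)|$ (equal to $\infty$ if $\cos\rho(A)=0$). $\ln$ is the natural logarithm. *)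

theory Defs
  imports "HOL-Probability.Probability"
begin

section \<open>Spherical caps and the GCC condition number\<close>

text \<open>
  The unit sphere \<open>S\<^sup>m\<close> is \<open>sphere 0 1 :: (real^'d) set\<close> with \<open>CARD('d) = m + 1\<close>.  A point of
  \<open>(S\<^sup>m)\<^sup>n\<close> is a function \<open>A\<close> whose values at the indices \<open>i < n\<close> are the rows
  \<open>a\<^sub>1, \<dots>, a\<^sub>n\<close>.
\<close>

definition cap :: "real^'d \<Rightarrow> real \<Rightarrow> (real^'d) set" where
  "cap p \<alpha> = {x \<in> sphere 0 1. p \<bullet> x \<ge> cos \<alpha>}"

definition including_cap :: "nat \<Rightarrow> (nat \<Rightarrow> real^'d) \<Rightarrow> real^'d \<Rightarrow> real \<Rightarrow> bool" where
  "including_cap n A p \<alpha> \<longleftrightarrow> p \<in> sphere 0 1 \<and> \<alpha> \<in> {0..pi} \<and> (\<forall>i<n. A i \<in> cap p \<alpha>)"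

definition smallest_including_cap :: "nat \<Rightarrow> (nat \<Rightarrow> real^'d) \<Rightarrow> real^'d \<Rightarrow> real \<Rightarrow> bool" where
  "smallest_including_cap n A p \<alpha> \<longleftrightarrow>
     including_cap n A p \<alpha> \<and> (\<forall>q \<beta>. including_cap n A q \<beta> \<longrightarrow> \<alpha> \<le> \<beta>)"

definition sic_radius :: "nat \<Rightarrow> (nat \<Rightarrow> real^'d) \<Rightarrow> real" where
  "sic_radius n A = (THE \<alpha>. \<exists>p. smallest_including_cap n A p \<alpha>)"

definition gcc_cond :: "nat \<Rightarrow> (nat \<Rightarrow> real^'d) \<Rightarrow> ereal" where
  "gcc_cond n A =
     (if cos (sic_radius n A) = 0 then \<infinity> else ereal (1 / \<bar>cos (sic_radius n A)\<bar>))"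

definition ln_ext :: "ereal \<Rightarrow> ereal" where
  "ln_ext x = (if x \<le> 0 then -\<infinity> else if x = \<infinity> then \<infinity> else ereal (ln (real_of_ereal x)))"

lemma smallest_including_cap_exists:
  fixes A :: "nat \<Rightarrow> real^'d"
  assumes A: "\<And>i. i < n \<Longrightarrow> A i \<in> sphere 0 1"
  shows "\<exists>p \<alpha>. smallest_including_cap n A p \<alpha>"
proof -
  define K where "K = {x \<in> sphere (0::real^'d) 1 \<times> {0..pi}. \<forall>i<n. cos (snd x) \<le> fst x \<bullet> A i}"
  have K: "including_cap n A p \<alpha> \<longleftrightarrow> (p, \<alpha>) \<in> K" for p \<alpha>
    using A by (auto simp: including_cap_def K_def cap_def)
  have "closed {x. \<forall>i<n. cos (snd x) \<le> fst x \<bullet> A i}"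
    by (intro closed_Collect_all closed_Collect_imp closed_Collect_le open_Collect_const continuous_intros)
  then have "compact ((sphere 0 1 \<times> {0..pi}) \<inter> {x. \<forall>i<n. cos (snd x) \<le> fst x \<bullet> A i})"
    by (intro compact_Int_closed compact_Times compact_sphere compact_Icc)
  also have "(sphere 0 1 \<times> {0..pi}) \<inter> {x. \<forall>i<n. cos (snd x) \<le> fst x \<bullet> A i} = K"
    by (auto simp: K_def)
  finally have "compact K" .
  moreover have "K \<noteq> {}"
  proof -
    obtain p :: "real^'d" where p: "norm p = 1"
      using vector_choose_size[of 1] by auto
    have "-1 \<le> p \<bullet> A i" if "i < n" for i
      using Cauchy_Schwarz_ineq2[of p "A i"] A[OF that] p by auto
    then have "(p, pi) \<in> K" using p by (auto simp: K_def)
    then show ?thesis by auto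
  qed
  moreover have "continuous_on K snd"
    by (intro continuous_intros)
  ultimately have "\<exists>x\<in>K. \<forall>y\<in>K. snd x \<le> snd y"
    by (rule continuous_attains_inf)
  then obtain x where "x \<in> K" "\<forall>y\<in>K. snd x \<le> snd y" by blast
  then have "smallest_including_cap n A (fst x) (snd x)"
    unfolding smallest_including_cap_def K by (metis prod.collapse snd_conv)
  then show ?thesis by blast
qed

lemma smallest_including_cap_sic_radius:
  fixes A :: "nat \<Rightarrow> real^'d"
  assumes A: "\<And>i. i < n \<Longrightarrow> A i \<in> sphere 0 1"
  shows "\<exists>p. smallest_including_cap n A p (sic_radius n A)"
proof -
  have "\<exists>!\<alpha>. \<exists>p. smallest_including_cap n A p \<alpha>"
    using smallest_including_cap_exists[of n A, OF A]
    by (auto simp: smallest_including_cap_def intro: order_antisym)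
  then show ?thesis
    unfolding sic_radius_def by (rule theI')
qed

lemma gcc_cond_ge_1: "1 \<le> gcc_cond n A"
  using abs_cos_le_one[of "sic_radius n A"] by (auto simp: gcc_cond_def field_simps)

lemma ln_ext_gcc_cond_nonneg: "0 \<le> ln_ext (gcc_cond n A)"
  using gcc_cond_ge_1[of n A] by (cases "gcc_cond n A") (auto simp: ln_ext_def)


section \<open>The uniform distribution on the sphere\<close>

text \<open>
  The normalised surface measure on the sphere is obtained as the distribution of \<open>x / \<parallel>x\<parallel>\<close> for
  \<open>x\<close> uniform in the unit ball (cone measure); its space is the sphere itself.  It is a
  probability measure invariant under all orthogonal transformations, which determines it.
\<close>

definition uniform_sphere :: "(real^'d) measure" where
  "uniform_sphere =
     restrict_space (distr (uniform_measure lborel (ball 0 1)) borel (\<lambda>x. x /\<^sub>R norm x)) (sphere 0 1)"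

definition uniform_points :: "nat \<Rightarrow> (nat \<Rightarrow> real^'d) measure" where
  "uniform_points n = (\<Pi>\<^sub>M i\<in>{..<n}. uniform_sphere)"

lemma space_uniform_sphere [simp]: "space uniform_sphere = sphere 0 1"
  by (simp add: uniform_sphere_def space_restrict_space)

lemma sets_uniform_sphere: "sets uniform_sphere = sets (restrict_space borel (sphere 0 1))"
  by (simp add: uniform_sphere_def sets_restrict_space)

lemma emeasure_ball_pos_finite:
  "emeasure lborel (ball (0::real^'d) 1) \<noteq> 0" "emeasure lborel (ball (0::real^'d) 1) \<noteq> \<infinity>"
proof -
  have "measure lborel (ball (0::real^'d) 1) > 0"
    by (simp add: content_ball_pos)
  then show "emeasure lborel (ball (0::real^'d) 1) \<noteq> 0"
    by (auto simp: measure_def)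
  show "emeasure lborel (ball (0::real^'d) 1) \<noteq> \<infinity>"
    using emeasure_lborel_ball_finite[of "0::real^'d" 1] by auto
qed

lemma emeasure_uniform_sphere:
  assumes "B \<in> sets borel" "B \<subseteq> sphere (0::real^'d) 1"
  shows "emeasure uniform_sphere B =
    emeasure lborel {x \<in> ball 0 1. x /\<^sub>R norm x \<in> B} / emeasure lborel (ball (0::real^'d) 1)"
proof -
  have "(\<lambda>x. x /\<^sub>R norm x) -` B \<in> sets (borel :: (real^'d) measure)"
    using measurable_sets[of "\<lambda>x::real^'d. x /\<^sub>R norm x" borel borel B] assms by simp
  then show ?thesis
    using assms
    by (simp add: uniform_sphere_def emeasure_restrict_space emeasure_distr)
       (auto intro!: arg_cong[where f="\<lambda>S. emeasure lborel S / _"])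
qed

lemma prob_space_uniform_sphere: "prob_space (uniform_sphere :: (real^'d) measure)"
proof
  have "emeasure lborel {x \<in> ball 0 1. x /\<^sub>R norm x \<in> sphere (0::real^'d) 1} =
        emeasure lborel (ball 0 1 - {0::real^'d})"
    by (rule arg_cong[where f="emeasure lborel"]) auto
  also have "\<dots> = emeasure lborel (ball (0::real^'d) 1)"
    using emeasure_Diff_null_set[of "{0::real^'d}" lborel "ball 0 1"] by (simp add: null_sets_def)
  finally show "emeasure uniform_sphere (space (uniform_sphere :: (real^'d) measure)) = 1"
    using emeasure_ball_pos_finite[where 'd='d]
    by (simp add: emeasure_uniform_sphere ennreal_divide_self less_top)
qed

lemma nn_integral_lborel_translate:
  fixes h :: "'a::euclidean_space \<Rightarrow> ennreal"
  assumes "h \<in> borel_measurable borel"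
  shows "(\<integral>\<^sup>+x. h (c + x) \<partial>lborel) = (\<integral>\<^sup>+x. h x \<partial>lborel)"
proof -
  have "(\<integral>\<^sup>+x. h x \<partial>lborel) = (\<integral>\<^sup>+x. h x \<partial>distr lborel borel ((+) c))"
    by (simp add: lborel_distr_plus)
  also have "\<dots> = (\<integral>\<^sup>+x. h (c + x) \<partial>lborel)"
    using assms by (simp add: nn_integral_distr)
  finally show ?thesis by simp
qed

lemma distr_lborel_orthogonal:
  fixes f :: "real^'d \<Rightarrow> real^'d"
  assumes f: "orthogonal_transformation f"
  shows "distr lborel borel f = lborel"
proof (rule measure_eqI)
  have lin: "linear f" using f by (rule orthogonal_transformation_linear)
  have nrm: "norm (f x) = norm x" for x using f by (rule orthogonal_transformation_norm)
  have meas [measurable]: "f \<in> borel_measurable borel"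
    using lin by (intro borel_measurable_continuous_onI linear_continuous_on)
      (simp add: linear_conv_bounded_linear)
  have surj: "\<exists>x. f x = y" for y
    using orthogonal_transformation_surj[OF f] by (metis surjD)
  fix A assume "A \<in> sets (distr lborel borel f)"
  then have A [measurable]: "A \<in> sets borel" by simp
  define B where "B = ball (0::real^'d) 1"
  have B [measurable]: "B \<in> sets borel" by (simp add: B_def)
  have "emeasure (distr lborel borel f) A * emeasure lborel B
      = (\<integral>\<^sup>+x. indicator A (f x) * emeasure lborel B \<partial>lborel)"
    using nn_integral_distr[of f lborel borel "indicator A :: _ \<Rightarrow> ennreal"]
    by (simp add: nn_integral_multc)
  also have "\<dots> = (\<integral>\<^sup>+x. \<integral>\<^sup>+y. indicator A (f x) * indicator B (y - f x) \<partial>lborel \<partial>lborel)"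
  proof (rule nn_integral_cong)
    fix x
    have "(\<integral>\<^sup>+y. indicator B (- f x + y) \<partial>lborel) = emeasure lborel B"
      using nn_integral_lborel_translate[of "indicator B" "- f x"] by simp
    then show "indicator A (f x) * emeasure lborel B
        = (\<integral>\<^sup>+y. indicator A (f x) * indicator B (y - f x) \<partial>lborel)"
      by (simp add: nn_integral_cmult)
  qed
  also have "\<dots> = (\<integral>\<^sup>+y. \<integral>\<^sup>+x. indicator A (f x) * indicator B (y - f x) \<partial>lborel \<partial>lborel)"
    by (rule lborel_pair.Fubini'[symmetric]) measurable
  also have "\<dots> = (\<integral>\<^sup>+y. \<integral>\<^sup>+x. indicator A (f x + y) * indicator B (- f x) \<partial>lborel \<partial>lborel)"
  proof (rule nn_integral_cong)
    fix y
    obtain z where z: "f z = y" using surj by blast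
    have "(\<integral>\<^sup>+x. indicator A (f x) * indicator B (y - f x) \<partial>lborel)
        = (\<integral>\<^sup>+x. indicator A (f (z + x)) * indicator B (y - f (z + x)) \<partial>lborel)"
      by (rule nn_integral_lborel_translate[symmetric]) measurable
    then show "(\<integral>\<^sup>+x. indicator A (f x) * indicator B (y - f x) \<partial>lborel)
        = (\<integral>\<^sup>+x. indicator A (f x + y) * indicator B (- f x) \<partial>lborel)"
      by (simp add: linear_add[OF lin] z add.commute)
  qed
  also have "\<dots> = (\<integral>\<^sup>+x. \<integral>\<^sup>+y. indicator A (f x + y) * indicator B (- f x) \<partial>lborel \<partial>lborel)"
    by (rule lborel_pair.Fubini') measurable
  also have "\<dots> = (\<integral>\<^sup>+x. emeasure lborel A * indicator B x \<partial>lborel)"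
  proof (rule nn_integral_cong)
    fix x
    have "(\<integral>\<^sup>+y. indicator A (f x + y) \<partial>lborel) = emeasure lborel A"
      using nn_integral_lborel_translate[of "indicator A" "f x"] by simp
    then show "(\<integral>\<^sup>+y. indicator A (f x + y) * indicator B (- f x) \<partial>lborel)
        = emeasure lborel A * indicator B x"
      by (simp add: nn_integral_multc) (simp add: B_def indicator_def nrm)
  qed
  also have "\<dots> = emeasure lborel A * emeasure lborel B"
    by (simp add: nn_integral_cmult)
  finally show "emeasure (distr lborel borel f) A = emeasure lborel A"
    using emeasure_ball_pos_finite[where 'd='d] unfolding B_def
    by (simp add: mult.commute[of _ "emeasure lborel (ball _ _)"] ennreal_mult_cancel_left)
qed simp

lemma uniform_sphere_orthogonal_invariant:
  fixes f :: "real^'d \<Rightarrow> real^'d"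
  assumes f: "orthogonal_transformation f"
  shows "distr uniform_sphere uniform_sphere f = uniform_sphere"
proof (rule measure_eqI)
  have lin: "linear f" using f by (rule orthogonal_transformation_linear)
  have nrm: "norm (f x) = norm x" for x using f by (rule orthogonal_transformation_norm)
  have meas: "f \<in> borel_measurable borel"
    using lin by (intro borel_measurable_continuous_onI linear_continuous_on)
      (simp add: linear_conv_bounded_linear)
  have meas': "f \<in> measurable uniform_sphere uniform_sphere"
    unfolding measurable_cong_sets[OF sets_uniform_sphere sets_uniform_sphere]
    using meas by (intro measurable_restrict_space3) (auto simp: nrm)
  fix B assume "B \<in> sets (distr uniform_sphere uniform_sphere f)"
  then have B: "B \<in> sets borel" "B \<subseteq> sphere 0 1"
    by (auto simp: sets_uniform_sphere sets_restrict_space_iff)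
  have fB1: "f -` B \<in> sets borel"
    using measurable_sets[OF meas B(1)] by simp
  have fB2: "f -` B \<subseteq> sphere 0 1"
  proof
    fix x assume "x \<in> f -` B"
    then have "norm (f x) = 1" using B(2) by auto
    then show "x \<in> sphere 0 1" by (simp add: nrm)
  qed
  note fB = fB1 fB2
  have "{x \<in> ball 0 1. x /\<^sub>R norm x \<in> B} = ball 0 1 \<inter> (\<lambda>x. x /\<^sub>R norm x) -` B" by auto
  then have cone: "{x \<in> ball 0 1. x /\<^sub>R norm x \<in> B} \<in> sets borel"
    using measurable_sets[of "\<lambda>x::real^'d. x /\<^sub>R norm x" borel borel B] B by simp
  have "emeasure (distr uniform_sphere uniform_sphere f) B = emeasure uniform_sphere (f -` B)"
    using B fB meas'
    by (subst emeasure_distr) (auto simp: sets_uniform_sphere sets_restrict_space_iff Int_absorb2)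
  also have "\<dots> = emeasure lborel (f -` {x \<in> ball 0 1. x /\<^sub>R norm x \<in> B}) / emeasure lborel (ball (0::real^'d) 1)"
    using fB by (simp add: emeasure_uniform_sphere)
      (auto intro!: arg_cong[where f="\<lambda>S. emeasure lborel S / _"] simp: nrm linear_scale[OF lin])
  also have "emeasure lborel (f -` {x \<in> ball 0 1. x /\<^sub>R norm x \<in> B}) =
      emeasure (distr lborel borel f) {x \<in> ball 0 1. x /\<^sub>R norm x \<in> B}"
    using cone meas by (simp add: emeasure_distr)
  finally show "emeasure (distr uniform_sphere uniform_sphere f) B = emeasure uniform_sphere B"
    using B by (simp add: distr_lborel_orthogonal[OF f] emeasure_uniform_sphere)
qed simp


section \<open>Measurability of the condition number\<close>

lemma sic_radius_less_iff:
  fixes A :: "nat \<Rightarrow> real^'d"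
  assumes A: "\<And>i. i < n \<Longrightarrow> A i \<in> sphere 0 1" and t: "0 < t" "t \<le> pi"
  shows "sic_radius n A < t \<longleftrightarrow> (\<exists>p\<in>sphere 0 1. \<forall>i<n. cos t < p \<bullet> A i)"
proof
  obtain p where p: "smallest_including_cap n A p (sic_radius n A)"
    using smallest_including_cap_sic_radius[of n A, OF A] by blast
  then have p': "p \<in> sphere 0 1" "sic_radius n A \<in> {0..pi}" "\<forall>i<n. cos (sic_radius n A) \<le> p \<bullet> A i"
    by (auto simp: smallest_including_cap_def including_cap_def cap_def)
  show "\<exists>p\<in>sphere 0 1. \<forall>i<n. cos t < p \<bullet> A i" if "sic_radius n A < t"
  proof -
    have "cos t < cos (sic_radius n A)"
      using that p'(2) t by (intro cos_monotone_0_pi) auto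
    then show ?thesis using p' by force
  qed
  assume "\<exists>p\<in>sphere 0 1. \<forall>i<n. cos t < p \<bullet> A i"
  then obtain q where q: "norm q = 1" "\<forall>i<n. cos t < q \<bullet> A i" by auto
  define c where "c = Min (insert 1 ((\<lambda>i. q \<bullet> A i) ` {..<n}))"
  have "c \<in> insert 1 ((\<lambda>i. q \<bullet> A i) ` {..<n})"
    unfolding c_def by (intro Min_in) auto
  moreover have "cos t < 1"
    using cos_monotone_0_pi[of 0 t] t by simp
  ultimately have ct: "cos t < c" using q by auto
  have c1: "c \<le> 1" and ci: "\<forall>i<n. c \<le> q \<bullet> A i" unfolding c_def by auto
  have cm: "-1 \<le> c" using ct cos_ge_minus_one[of t] by linarith
  have "including_cap n A q (arccos c)"
    using q A c1 cm ci by (auto simp: including_cap_def cap_def arccos_lbound arccos_ubound)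
  then have "sic_radius n A \<le> arccos c"
    using p by (auto simp: smallest_including_cap_def)
  also have "arccos c < arccos (cos t)"
    using ct c1 cm by (intro arccos_less_arccos) auto
  also have "\<dots> = t" using t by (simp add: arccos_cos)
  finally show "sic_radius n A < t" .
qed

lemma space_uniform_points: "space (uniform_points n) = {..<n} \<rightarrow>\<^sub>E sphere 0 1"
  by (simp add: uniform_points_def space_PiM)

lemma prob_space_uniform_points: "prob_space (uniform_points n :: (nat \<Rightarrow> real^'d) measure)"
  unfolding uniform_points_def by (intro prob_space_PiM prob_space_uniform_sphere)

lemma measurable_sic_radius [measurable]:
  "(sic_radius n :: (nat \<Rightarrow> real^'d) \<Rightarrow> real) \<in> borel_measurable (uniform_points n)"
proof (rule borel_measurableI_less)
  let ?M = "uniform_points n :: (nat \<Rightarrow> real^'d) measure"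
  fix t :: real
  have sph: "A i \<in> sphere 0 1" if "A \<in> space ?M" "i < n" for A i
    using that by (auto simp only: space_uniform_points lessThan_iff elim: PiE_mem)
  have rng: "sic_radius n A \<in> {0..pi}" if "A \<in> space ?M" for A
    using smallest_including_cap_sic_radius[of n A, OF sph[OF that]]
    unfolding smallest_including_cap_def including_cap_def by blast
  consider "t \<le> 0" | "t > pi" | "0 < t" "t \<le> pi" by linarith
  then show "{A \<in> space ?M. sic_radius n A < t} \<in> sets ?M"
  proof cases
    case 1
    then have "{A \<in> space ?M. sic_radius n A < t} = {}" using rng by force
    then show ?thesis by (simp only: sets.empty_sets)
  next
    case 2
    then have "{A \<in> space ?M. sic_radius n A < t} = space ?M" using rng by force
    then show ?thesis by (simp only: sets.top)
  next
    case 3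
    obtain D where D: "countable D" "D \<subseteq> sphere (0::real^'d) 1" "sphere 0 1 \<subseteq> closure D"
      using separable[of "sphere (0::real^'d) 1"] by blast
    have dense: "(\<exists>p\<in>sphere 0 1. \<forall>i<n. cos t < p \<bullet> A i) \<longleftrightarrow> (\<exists>p\<in>D. \<forall>i<n. cos t < p \<bullet> A i)"
      for A :: "nat \<Rightarrow> real^'d"
    proof
      assume "\<exists>p\<in>sphere 0 1. \<forall>i<n. cos t < p \<bullet> A i"
      then obtain p where p: "p \<in> sphere 0 1" "\<forall>i<n. cos t < p \<bullet> A i" by blast
      define U where "U = (\<Inter>i\<in>{..<n}. {q. cos t < q \<bullet> A i})"
      have "open U"
        unfolding U_def by (intro open_INT ballI open_Collect_less continuous_intros) auto
      moreover have "p \<in> U" "p \<in> closure D" using p D by (auto simp: U_def)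
      ultimately have "U \<inter> D \<noteq> {}" using open_Int_closure_eq_empty[of U D] by blast
      then show "\<exists>p\<in>D. \<forall>i<n. cos t < p \<bullet> A i" by (auto simp: U_def)
    qed (use D in blast)
    have "{A \<in> space ?M. sic_radius n A < t} = {A \<in> space ?M. \<exists>p\<in>D. \<forall>i\<in>{..<n}. cos t < p \<bullet> A i}"
    proof (rule Collect_cong, rule conj_cong[OF refl])
      fix A assume A: "A \<in> space ?M"
      have "sic_radius n A < t \<longleftrightarrow> (\<exists>p\<in>sphere 0 1. \<forall>i<n. cos t < p \<bullet> A i)"
        using 3 by (intro sic_radius_less_iff sph[OF A])
      then show "sic_radius n A < t \<longleftrightarrow> (\<exists>p\<in>D. \<forall>i\<in>{..<n}. cos t < p \<bullet> A i)"
        by (simp only: dense) (simp only: Ball_def lessThan_iff)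
    qed
    also have "\<dots> \<in> sets ?M"
    proof -
      have comp: "(\<lambda>A. A i) \<in> borel_measurable ?M" if "i < n" for i
      proof -
        have "(\<lambda>A. A i) \<in> measurable ?M uniform_sphere"
          unfolding uniform_points_def using that by (intro measurable_component_singleton) auto
        then have "(\<lambda>A. A i) \<in> measurable ?M (restrict_space borel (sphere 0 1))"
          using measurable_cong_sets[OF refl sets_uniform_sphere] by blast
        then show ?thesis by (simp add: measurable_restrict_space2_iff)
      qed
      have "{A \<in> space ?M. cos t < p \<bullet> A i} \<in> sets ?M" if "i \<in> {..<n}" for p i
        using that by (intro borel_measurable_less borel_measurable_inner borel_measurable_const comp) simp
      then show ?thesis
        by (intro sets.sets_Collect_countable_Ex' sets.sets_Collect_countable_All' D(1)) auto
    qed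
    finally show ?thesis .
  qed
qed

lemma measurable_gcc_cond [measurable]:
  "(gcc_cond n :: (nat \<Rightarrow> real^'d) \<Rightarrow> ereal) \<in> borel_measurable (uniform_points n)"
  unfolding gcc_cond_def by measurable

lemma measurable_ln_ext_gcc_cond [measurable]:
  "(\<lambda>A. ln_ext (gcc_cond n A)) \<in> borel_measurable (uniform_points n :: (nat \<Rightarrow> real^'d) measure)"
proof -
  have "ln_ext (gcc_cond n A) =
      (if cos (sic_radius n A) = 0 then \<infinity> else ereal (ln (1 / \<bar>cos (sic_radius n A)\<bar>)))"
    for A :: "nat \<Rightarrow> real^'d"
    by (simp add: gcc_cond_def ln_ext_def)
  then show ?thesis by simp
qed

end

theory Submission
  imports Defs "HOL-Real_Asymp.Real_Asymp"
begin

text \<open>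
  Put \<open>d = m + 1\<close> and \<open>t = cos \<rho>(A) = max\<^sub>p min\<^sub>i \<langle>p, a\<^sub>i\<rangle>\<close>.  The tail estimate \<open>P(\<bar>t\<bar> < \<epsilon>) \<le> 10 d\<^sup>2 \<epsilon>\<close>,
  uniform in \<open>n\<close>, integrates to \<open>E(ln (1 / \<bar>t\<bar>)) \<le> ln (10 d\<^sup>2) + 1\<close>.  To prove it, lower the thresholds
  in the conditions \<open>\<langle>p, a\<^sub>i\<rangle> > \<epsilon>\<close> to \<open>-\<epsilon>\<close> one row at a time.  When the other rows are fixed, let \<open>P\<close>
  be the set of the \<open>p\<close> that they admit; the change of the \<open>i\<close>-th threshold matters only if
  \<open>-\<epsilon> < max\<^sub>p\<^sub>\<in>\<^sub>P \<langle>p, a\<^sub>i\<rangle> \<le> \<epsilon>\<close>, which has probability at most \<open>2.2 \<surd>d \<epsilon>\<close>: translating each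
  piece of this slab along its own normal \<open>p\<close> packs about \<open>1 / (\<epsilon> \<surd>d)\<close> disjoint copies of it into a
  ball.  Moreover \<open>P\<close> has to be nonempty.  By independence, the probability of this decays
  geometrically over blocks of \<open>5 d\<close> rows, with ratio \<open>0.55\<close>; the ratio comes from symmetry under
  sign changes of the rows and from the Sauer--Shelah bound on the number of sign patterns cut out
  by half-spaces.
\<close>

section \<open>Slabs around convex cones\<close>

text \<open>Dominance cells of the linear functionals in \<open>P\<close>. Breaking ties by
  \<open>idx\<close> makes the cells disjoint exactly, not merely up to null sets, once
  \<open>idx\<close> is injective on \<open>P\<close>.\<close>

definition argmax_cell :: "('a::real_inner) set \<Rightarrow> ('a \<Rightarrow> nat) \<Rightarrow> 'a \<Rightarrow> 'a set" where
  "argmax_cell P idx p = {y. \<forall>q\<in>P. q \<bullet> y < p \<bullet> y \<or> q \<bullet> y = p \<bullet> y \<and> idx p \<le> idx q}"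

lemma argmax_cell_exists:
  assumes "finite P" "P \<noteq> {}"
  shows "\<exists>p\<in>P. y \<in> argmax_cell P idx p"
proof -
  have m: "Max ((\<lambda>q. q \<bullet> y) ` P) \<in> (\<lambda>q. q \<bullet> y) ` P"
    using assms by (intro Max_in) auto
  define Q where "Q = {q \<in> P. q \<bullet> y = Max ((\<lambda>q. q \<bullet> y) ` P)}"
  from m obtain p where "p \<in> P" "p \<bullet> y = Max ((\<lambda>q. q \<bullet> y) ` P)" by (metis imageE)
  then have "finite Q" "Q \<noteq> {}" using assms by (auto simp: Q_def)
  then obtain p where p: "p \<in> Q" "\<And>q. q \<in> Q \<Longrightarrow> idx p \<le> idx q"
    by (metis arg_min_if_finite(1) arg_min_least)
  have "q \<bullet> y \<le> Max ((\<lambda>q. q \<bullet> y) ` P)" if "q \<in> P" for q using assms that by auto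
  then have "y \<in> argmax_cell P idx p"
    using p unfolding argmax_cell_def Q_def by force
  then show ?thesis using p(1) by (auto simp: Q_def)
qed

lemma argmax_cell_unique:
  assumes "inj_on idx P" "p \<in> P" "q \<in> P" "y \<in> argmax_cell P idx p" "y \<in> argmax_cell P idx q"
  shows "p = q"
proof -
  have "q \<bullet> y < p \<bullet> y \<or> q \<bullet> y = p \<bullet> y \<and> idx p \<le> idx q"
    "p \<bullet> y < q \<bullet> y \<or> p \<bullet> y = q \<bullet> y \<and> idx q \<le> idx p"
    using assms(2-5) by (simp_all add: argmax_cell_def)
  then have "idx p = idx q" by auto
  then show ?thesis using assms(1-3) by (simp add: inj_on_def)
qed

text \<open>Among unit vectors \<open>q\<close>, the product \<open>q \<bullet> p\<close> is
  largest, and strictly so, at \<open>q = p\<close>. Moving along \<open>p\<close> thus favours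
  \<open>p\<close> over every competitor. This keeps shifted slab pieces inside their cells.\<close>

lemma argmax_cell_affine:
  assumes P: "P \<subseteq> sphere 0 1" "p \<in> P" and y: "y \<in> argmax_cell P idx p" and "0 < r" "0 \<le> s"
  shows "r *\<^sub>R y + s *\<^sub>R p \<in> argmax_cell P idx p"
proof -
  have "q \<bullet> (r *\<^sub>R y + s *\<^sub>R p) < p \<bullet> (r *\<^sub>R y + s *\<^sub>R p) \<or>
        q \<bullet> (r *\<^sub>R y + s *\<^sub>R p) = p \<bullet> (r *\<^sub>R y + s *\<^sub>R p) \<and> idx p \<le> idx q" if q: "q \<in> P" for q
  proof -
    have np: "p \<bullet> p = 1" "q \<bullet> q = 1" using P q by (auto simp: power2_norm_eq_inner[symmetric] subset_iff)
    have "q \<bullet> p \<le> norm q * norm p" by (rule norm_cauchy_schwarz)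
    then have "q \<bullet> p \<le> p \<bullet> p" using P q np by (auto simp: subset_iff)
    then have "s * (q \<bullet> p) \<le> s * (p \<bullet> p)" using \<open>0 \<le> s\<close> by (rule mult_left_mono)
    moreover have "q = p \<or> q \<bullet> p < 1"
    proof (rule ccontr)
      assume "\<not> (q = p \<or> q \<bullet> p < 1)"
      moreover have "(q - p) \<bullet> (q - p) = 2 - 2 * (q \<bullet> p)"
        using np by (simp add: inner_diff inner_commute)
      moreover have "(q - p) \<bullet> (q - p) \<ge> 0" by simp
      ultimately show False using \<open>q \<bullet> p \<le> p \<bullet> p\<close> np by auto
    qed
    moreover have "r * (q \<bullet> y) < r * (p \<bullet> y) \<or> q \<bullet> y = p \<bullet> y \<and> idx p \<le> idx q"
      using y q \<open>0 < r\<close> by (auto simp: argmax_cell_def)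
    moreover have "s * (q \<bullet> p) < s * (p \<bullet> p) \<or> s = 0 \<or> q = p"
      using \<open>q = p \<or> q \<bullet> p < 1\<close> \<open>0 \<le> s\<close> np mult_strict_left_mono[of "q \<bullet> p" 1 s]
      by (cases "s = 0") auto
    ultimately show ?thesis
      unfolding inner_add_right inner_scaleR_right by auto
  qed
  then show ?thesis by (simp add: argmax_cell_def)
qed

lemma argmax_cell_borel [measurable]:
  assumes "finite P"
  shows "argmax_cell P idx p \<in> sets (borel :: ('a::euclidean_space) measure)"
  unfolding argmax_cell_def using assms by measurable

text \<open>On its cell, \<open>p \<bullet> y\<close> is the maximum over \<open>P\<close>, so a
  condition on the whole family reduces to one linear functional.\<close>

lemma inside_slab_iff:
  assumes y: "y \<in> argmax_cell P idx p" and p: "p \<in> P"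
  shows "(\<exists>q\<in>P. a < q \<bullet> y) \<and> \<not> (\<exists>q\<in>P. b < q \<bullet> y) \<longleftrightarrow> a < p \<bullet> y \<and> p \<bullet> y \<le> b"
proof
  assume "(\<exists>q\<in>P. a < q \<bullet> y) \<and> \<not> (\<exists>q\<in>P. b < q \<bullet> y)"
  then obtain q where q: "q \<in> P" "a < q \<bullet> y" "p \<bullet> y \<le> b" using p by (meson not_less)
  moreover have "q \<bullet> y \<le> p \<bullet> y" using y q(1) by (auto simp: argmax_cell_def less_imp_le)
  ultimately show "a < p \<bullet> y \<and> p \<bullet> y \<le> b" by linarith
next
  assume *: "a < p \<bullet> y \<and> p \<bullet> y \<le> b"
  have "q \<bullet> y \<le> b" if "q \<in> P" for q
  proof -
    have "q \<bullet> y \<le> p \<bullet> y" using y that by (auto simp: argmax_cell_def less_imp_le)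
    then show ?thesis using * by linarith
  qed
  then show "(\<exists>q\<in>P. a < q \<bullet> y) \<and> \<not> (\<exists>q\<in>P. b < q \<bullet> y)"
    using * p by (meson not_less)
qed

section \<open>Packing shifted slabs into the ball\<close>

lemma bernoulli_even:
  fixes r :: real
  assumes "0 \<le> r" "r \<le> 1" "2 \<le> n"
  shows "1 - real n / 2 * (1 - r\<^sup>2) \<le> r ^ n"
  using assms(3)
proof (induction n rule: nat_less_induct)
  case (1 n)
  \<comment> \<open>This is Bernoulli's inequality for \<open>r\<^sup>2\<close> with exponent
    \<open>n / 2\<close>. Induction in steps of two avoids fractional powers and calls for one base
    case per parity.\<close>
  have "n = 2 \<or> n = 3 \<or> n = (n - 2) + 2 \<and> 2 \<le> n - 2" using 1(2) by linarith
  then consider "n = 2" | "n = 3" | k where "n = k + 2" "2 \<le> k" by blast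
  then show ?case
  proof cases
    case 2
    \<comment> \<open>Twice the difference of the two sides factors in this way.\<close>
    have "0 \<le> (r - 1)\<^sup>2 * (2 * r + 1)" using assms by simp
    then show ?thesis using 2 by (simp add: power2_eq_square power3_eq_cube field_simps)
  next
    case 3
    have "(1 - real k / 2 * (1 - r\<^sup>2)) * r\<^sup>2 \<le> r ^ k * r\<^sup>2"
      using 1 3 by (intro mult_right_mono) auto
    \<comment> \<open>With \<open>x = 1 - r\<^sup>2\<close>, the product of
      \<open>1 - k / 2 * x\<close> and \<open>1 - x\<close> exceeds the bound for
      \<open>k + 2\<close> by \<open>k / 2 * x\<^sup>2\<close>.\<close>
    moreover have "0 \<le> real k * (1 - r\<^sup>2)\<^sup>2" by simp
    ultimately show ?thesis using 3
      by (simp add: power_add power2_eq_square field_simps)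
  qed simp
qed

lemma sum_consecutive_products: "(\<Sum>k<M. real k * (real k + 1)) \<le> real M ^ 3 / 3"
proof -
  have "(\<Sum>k<M. real k * (real k + 1)) = (real M ^ 3 - real M) / 3"
    by (induction M) (simp_all add: field_simps power3_eq_cube)
  then show ?thesis by simp
qed

text \<open>The map \<open>y \<mapsto> \<rho> y + k w p\<close> on the cell of \<open>p\<close> moves the slab orthogonally to itself, so that
  the norm grows only to second order; this gives the factor \<open>\<surd>d\<close> instead of \<open>d\<close>.\<close>

lemma slab_shift_bound:
  fixes P :: "(real^'d) set" and a b :: real and M :: nat
  assumes P: "finite P" "P \<noteq> {}" "P \<subseteq> sphere 0 1" and ab: "a < 0" "0 \<le> b" "a + b \<le> 0"
    and M: "(b - a)\<^sup>2 * real M ^ 2 \<le> 1" and d: "2 \<le> CARD('d)"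
  defines "E \<equiv> {y \<in> ball 0 1. (\<exists>q\<in>P. a < q \<bullet> y) \<and> \<not> (\<exists>q\<in>P. b < q \<bullet> y)}"
  shows "measure lebesgue E * (real M - real CARD('d) * (b - a)\<^sup>2 * real M ^ 3 / 6)
      \<le> measure lebesgue (ball (0::real^'d) 1)"
proof -
  define w where "w = b - a"
  have w: "0 < w" "2 * b \<le> w" using ab by (auto simp: w_def)
  obtain idx :: "real^'d \<Rightarrow> nat" where idx: "inj_on idx P"
    using P(1) by (metis finite_imp_inj_to_nat_seg)
  define C where "C = argmax_cell P idx"
  \<comment> \<open>A shift by \<open>k * w\<close> adds at most
    \<open>w\<^sup>2 * (k\<^sup>2 + k)\<close> to the squared norm: the square of the shift, and a
    cross term of at most \<open>2 * k * w * b \<le> k * w\<^sup>2\<close>. Shrinking by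
    \<open>rho k\<close> compensates exactly.\<close>
  define rho where "rho k = sqrt (1 - w\<^sup>2 * (real k * (real k + 1)))" for k
  have wk: "w\<^sup>2 * (real k * (real k + 1)) < 1" if "k < M" for k
  proof -
    have "k * (k + 1) < M * M"
      using that by (intro mult_less_le_imp_less) auto
    then have "real k * (real k + 1) < real M * real M"
      by (metis of_nat_less_iff of_nat_mult of_nat_Suc Suc_eq_plus1 add.commute)
    then have "w\<^sup>2 * (real k * (real k + 1)) < w\<^sup>2 * (real M * real M)"
      using w by (intro mult_strict_left_mono) auto
    then show ?thesis using M by (simp add: w_def power2_eq_square)
  qed
  have rho: "0 < rho k" "rho k \<le> 1" "(rho k)\<^sup>2 = 1 - w\<^sup>2 * (real k * (real k + 1))" if "k < M" for k
    using wk[OF that] w by (auto simp: rho_def)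
  have E_borel [measurable]: "E \<in> sets borel"
    unfolding E_def using P(1) by measurable
  have C_borel [measurable]: "C p \<in> sets borel" for p
    unfolding C_def using P(1) by measurable
  have lm: "S \<in> lmeasurable" if "S \<in> sets borel" "S \<subseteq> ball 0 1" for S :: "(real^'d) set"
    using that by (intro bounded_set_imp_lmeasurable bounded_subset[OF bounded_ball]) auto
  have E_cell: "a < p \<bullet> y \<and> p \<bullet> y \<le> b \<and> norm y < 1" if "y \<in> E" "y \<in> C p" "p \<in> P" for y p
    using inside_slab_iff[of y P idx p a b] that by (auto simp: E_def C_def)
  define G where "G k p = (\<lambda>y. (real k * w) *\<^sub>R p + rho k *\<^sub>R y) ` (E \<inter> C p)" for k p
  have G_eq: "G k p = (\<lambda>z. (1 / rho k) *\<^sub>R (z - (real k * w) *\<^sub>R p)) -` (E \<inter> C p)" if "k < M" for k p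
    using rho[OF that] by (force simp: G_def image_iff)
  have G_borel: "G k p \<in> sets borel" if "k < M" for k p
    unfolding G_eq[OF that]
    using measurable_sets[of "\<lambda>z. (1 / rho k) *\<^sub>R (z - (real k * w) *\<^sub>R p)" borel borel "E \<inter> C p"]
    by simp
  have G_meas: "measure lebesgue (G k p) = rho k ^ CARD('d) * measure lebesgue (E \<inter> C p)"
    if "k < M" for k p
    unfolding G_def using measure_lebesgue_affine[of "rho k" "(real k * w) *\<^sub>R p" "E \<inter> C p"] rho[OF that]
    by (simp add: add.commute)
  have G_prop: "z \<in> ball 0 1 \<and> z \<in> C p \<and> p \<bullet> z \<in> {a + real k * w<..b + real k * w}"
    if k: "k < M" and p: "p \<in> P" and z: "z \<in> G k p" for k p z
  proof -
    obtain y where y: "y \<in> E" "y \<in> C p" and zy: "z = (real k * w) *\<^sub>R p + rho k *\<^sub>R y"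
      using z by (auto simp: G_def)
    note r = rho[OF k] and e = E_cell[OF y p]
    have np: "p \<bullet> p = 1" using P(3) p by (auto simp: power2_norm_eq_inner[symmetric])
    have "p \<bullet> z = real k * w + rho k * (p \<bullet> y)" by (simp add: zy inner_right_distrib np)
    \<comment> \<open>Since \<open>a < 0 \<le> b\<close>, contracting by \<open>rho k\<close> toward
      0 keeps \<open>p \<bullet> y\<close> between \<open>a\<close> and \<open>b\<close>.\<close>
    moreover have "rho k * (p \<bullet> y) \<le> b"
    proof (cases "p \<bullet> y \<le> 0")
      case True
      then have "rho k * (p \<bullet> y) \<le> 0" using r by (simp add: mult_nonneg_nonpos)
      then show ?thesis using ab by linarith
    next
      case False
      then have "rho k * (p \<bullet> y) \<le> 1 * (p \<bullet> y)" using r by (intro mult_right_mono) auto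
      then show ?thesis using e by linarith
    qed
    moreover have "a < rho k * (p \<bullet> y)"
    proof (cases "0 \<le> p \<bullet> y")
      case True
      then have "rho k * (p \<bullet> y) \<ge> 0" using r by simp
      then show ?thesis using ab by linarith
    next
      case False
      then have "rho k * (p \<bullet> y) \<ge> 1 * (p \<bullet> y)" using r by (intro mult_right_mono_neg) auto
      then show ?thesis using e by linarith
    qed
    ultimately have in_slab: "p \<bullet> z \<in> {a + real k * w<..b + real k * w}" by auto
    have "(norm z)\<^sup>2 = (real k * w)\<^sup>2 + 2 * (real k * w) * (rho k * (p \<bullet> y)) + (rho k)\<^sup>2 * (norm y)\<^sup>2"
      unfolding power2_norm_eq_inner
      by (simp add: zy inner_add_left inner_add_right inner_commute np power2_eq_square algebra_simps)
    also have "2 * (real k * w) * (rho k * (p \<bullet> y)) \<le> 2 * (real k * w) * b"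
      using \<open>rho k * (p \<bullet> y) \<le> b\<close> w by (intro mult_left_mono) auto
    also have "2 * (real k * w) * b = (real k * w) * (2 * b)" by simp
    also have "\<dots> \<le> real k * w * w" using w by (intro mult_left_mono) auto
    also have "(rho k)\<^sup>2 * (norm y)\<^sup>2 < (rho k)\<^sup>2 * 1"
      using r(1) e by (intro mult_strict_left_mono zero_less_power) (auto simp: power_less_one_iff)
    finally have "(norm z)\<^sup>2 < 1" unfolding r(3) by (simp add: power2_eq_square algebra_simps)
    then have "norm z < 1" by (simp add: power_less_one_iff)
    moreover have "z \<in> C p"
      using argmax_cell_affine[OF P(3) p, of y idx "rho k" "real k * w"] y r w
      by (simp add: C_def zy add.commute)
    ultimately show ?thesis using in_slab by simp
  qed
  \<comment> \<open>Copies with different \<open>p\<close> lie in disjoint cells; copies with the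
    same \<open>p\<close> lie in adjacent half-open windows of width \<open>w\<close>.\<close>
  have disj: "disjoint_family_on (\<lambda>(k, p). G k p) ({..<M} \<times> P)"
  proof (unfold disjoint_family_on_def, clarsimp)
    fix k p l q assume kl: "k < M" "p \<in> P" "l < M" "q \<in> P" and ne: "k = l \<longrightarrow> p \<noteq> q"
    show "G k p \<inter> G l q = {}"
    proof (rule ccontr)
      assume "G k p \<inter> G l q \<noteq> {}"
      then obtain z where z: "z \<in> G k p" "z \<in> G l q" by blast
      note z1 = G_prop[OF kl(1,2) z(1)] and z2 = G_prop[OF kl(3,4) z(2)]
      have pq: "p = q"
        using argmax_cell_unique[OF idx kl(2,4)] z1 z2 by (auto simp: C_def)
      have "real k * w < real (l + 1) * w" "real l * w < real (k + 1) * w"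
        using z1 z2 pq by (auto simp: w_def algebra_simps)
      then have "k < l + 1" "l < k + 1" using w by (simp_all only: mult_less_cancel_right_pos of_nat_less_iff)
      then show False using ne pq by simp
    qed
  qed
  have "(\<Sum>(k, p)\<in>{..<M} \<times> P. measure lebesgue (G k p)) = measure lebesgue (\<Union>(k, p)\<in>{..<M} \<times> P. G k p)"
    using P(1) disj G_borel G_prop
    by (subst measure_finite_Union[where S = "{..<M} \<times> P" and A = "\<lambda>(k, p). G k p"])
      (auto simp: case_prod_unfold image_subset_iff intro!: fmeasurableD2 lm)
  also have "\<dots> \<le> measure lebesgue (ball (0::real^'d) 1)"
    using G_prop P(1) G_borel
    by (intro measure_mono_fmeasurable lmeasurable_ball sets.finite_UN) (auto intro!: sets_completionI_sets)
  also have "(\<Sum>(k, p)\<in>{..<M} \<times> P. measure lebesgue (G k p)) =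
      (\<Sum>k<M. rho k ^ CARD('d) * (\<Sum>p\<in>P. measure lebesgue (E \<inter> C p)))"
    by (simp add: sum.cartesian_product[symmetric] G_meas sum_distrib_left)
  also have "(\<Sum>p\<in>P. measure lebesgue (E \<inter> C p)) = measure lebesgue (\<Union>p\<in>P. E \<inter> C p)"
  proof (rule measure_finite_Union[symmetric, OF P(1)])
    show "(\<lambda>p. E \<inter> C p) ` P \<subseteq> sets lebesgue" by auto
    show "disjoint_family_on (\<lambda>p. E \<inter> C p) P"
      using argmax_cell_unique[OF idx] by (auto simp: disjoint_family_on_def C_def)
    show "emeasure lebesgue (E \<inter> C p) \<noteq> \<infinity>" for p
    proof -
      have "E \<inter> C p \<in> lmeasurable"
        by (rule lm[OF sets.Int[OF E_borel C_borel]]) (auto simp: E_def)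
      from fmeasurableD2[OF this] show ?thesis by simp
    qed
  qed
  also have "(\<Union>p\<in>P. E \<inter> C p) = E"
    using argmax_cell_exists[OF P(1,2), of _ idx] unfolding C_def by blast
  finally have *: "measure lebesgue E * (\<Sum>k<M. rho k ^ CARD('d)) \<le> measure lebesgue (ball (0::real^'d) 1)"
    by (simp add: sum_distrib_left mult.commute)
  \<comment> \<open>The total contraction factor is bounded from below: Bernoulli linearises each
    power in \<open>(rho k)\<^sup>2\<close>, which is a quadratic polynomial in
    \<open>k\<close>.\<close>
  have "real M - real CARD('d) * w\<^sup>2 * real M ^ 3 / 6
      \<le> real M - real CARD('d) * w\<^sup>2 / 2 * (\<Sum>k<M. real k * (real k + 1))"
    using mult_left_mono[OF sum_consecutive_products[of M], of "real CARD('d) * w\<^sup>2 / 2"] by simp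
  also have "\<dots> = (\<Sum>k<M. 1 - real CARD('d) / 2 * (1 - (rho k)\<^sup>2))"
    by (simp add: sum_subtractf sum_distrib_left rho mult.assoc)
  also have "\<dots> \<le> (\<Sum>k<M. rho k ^ CARD('d))"
    using d rho by (intro sum_mono bernoulli_even) (auto simp: less_imp_le)
  finally have "measure lebesgue E * (real M - real CARD('d) * w\<^sup>2 * real M ^ 3 / 6)
      \<le> measure lebesgue E * (\<Sum>k<M. rho k ^ CARD('d))"
    by (intro mult_left_mono) auto
  with * show ?thesis by (simp add: w_def)
qed

section \<open>Optimal number of copies, and transfer from the ball to the sphere\<close>

lemma measure_ball_pos: "0 < measure lebesgue (ball (0::real^'d) 1)"
  using content_ball_pos[of 1 "0::real^'d"] by simp

text \<open>In terms of \<open>x = z * M\<close> the packing factor is \<open>x - x ^ 3 / 6\<close>,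
  which for positive \<open>x\<close> is maximal at \<open>x = sqrt 2\<close> with value about
  0.943. Rounding \<open>M\<close> down changes \<open>x\<close> by at most \<open>z\<close>, and
  near a maximum this matters only to second order.\<close>

lemma floor_cubic_lower_bound:
  fixes z :: real
  assumes z: "0 < z" "z \<le> 1 / 5"
  defines "M \<equiv> real (nat \<lfloor>sqrt 2 / z\<rfloor>)"
  shows "10 / 11 \<le> z * (M - z\<^sup>2 * M ^ 3 / 6)" "z\<^sup>2 * M\<^sup>2 \<le> 2"
proof -
  define x where "x = sqrt 2 / z"
  have xz: "x * z = sqrt 2" "0 \<le> x" using z by (auto simp: x_def)
  have M: "M \<le> x" "x - 1 \<le> M" "0 \<le> M"
    using xz unfolding M_def x_def[symmetric] by (auto; linarith)+
  have zM: "z * M \<le> sqrt 2" "sqrt 2 - z \<le> z * M"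
    using mult_left_mono[OF M(1), of z] mult_left_mono[OF M(2), of z] z xz
    by (auto simp: algebra_simps)
  have "(z * M)\<^sup>2 \<le> (sqrt 2)\<^sup>2" using zM z M by (intro power_mono) auto
  then show "z\<^sup>2 * M\<^sup>2 \<le> 2" by (simp add: power_mult_distrib)
  define s where "s = sqrt (2::real)"
  define e where "e = s - z * M"
  have s2: "s * s = 2" by (simp add: s_def)
  have s: "141 / 100 \<le> s" unfolding s_def by (rule real_le_rsqrt) (simp add: power2_eq_square)
  have e: "0 \<le> e" "e \<le> 1 / 5" using zM z by (auto simp: e_def s_def)
  have eM: "z * M = s - e" by (simp add: e_def)
  \<comment> \<open>Expansion around the critical point: the linear terms in \<open>e\<close> cancel
    in \<open>x - x ^ 3 / 6\<close>.\<close>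
  have s3: "(s - e) ^ 3 = 2 * s - 6 * e + 3 * s * (e * e) - e * e * e"
    using s2 by (simp add: power3_eq_cube algebra_simps)
  have "z * (M - z\<^sup>2 * M ^ 3 / 6) = z * M - (z * M) ^ 3 / 6"
    by (simp add: power_mult_distrib power2_eq_square power3_eq_cube algebra_simps)
  also have "\<dots> = (2 / 3) * s - s * (e * e) / 2 + e * e * e / 6"
    unfolding eM s3 by (simp add: field_simps)
  finally have *: "z * (M - z\<^sup>2 * M ^ 3 / 6) = (2 / 3) * s - s * (e * e) / 2 + e * e * e / 6" .
  have "e * e \<le> (1 / 5) * (1 / 5)" using e by (intro mult_mono) auto
  then have "s * (e * e) \<le> s * (1 / 25)" using s by (intro mult_left_mono) auto
  moreover have "0 \<le> e * e * e" using e by simp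
  ultimately show "10 / 11 \<le> z * (M - z\<^sup>2 * M ^ 3 / 6)" unfolding * using s by linarith
qed

text \<open>The cone over the spherical slab lies in the slab of the ball: shrinking moves inner
  products toward 0, which belongs to the window. The packing bound, divided by the volume of the
  ball, then applies.\<close>

lemma uniform_sphere_slab_bound:
  fixes P :: "(real^'d) set" and a b :: real
  assumes P: "finite P" "P \<noteq> {}" "P \<subseteq> sphere 0 1" and ab: "a < 0" "0 \<le> b" "a + b \<le> 0"
    and w: "(b - a) * sqrt (real CARD('d)) \<le> 1 / 5" and d: "2 \<le> CARD('d)"
  shows "measure uniform_sphere {u \<in> sphere 0 1. (\<exists>q\<in>P. a < q \<bullet> u) \<and> \<not> (\<exists>q\<in>P. b < q \<bullet> u)}
      \<le> (11 / 10) * sqrt (real CARD('d)) * (b - a)"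
proof -
  define B where "B = {u \<in> sphere 0 1. (\<exists>q\<in>P. a < q \<bullet> u) \<and> \<not> (\<exists>q\<in>P. b < q \<bullet> u)}"
  define E where "E = {y \<in> ball 0 1. (\<exists>q\<in>P. a < q \<bullet> y) \<and> \<not> (\<exists>q\<in>P. b < q \<bullet> y)}"
  define V where "V = measure lebesgue (ball (0::real^'d) 1)"
  define z where "z = (b - a) * sqrt (real CARD('d))"
  define M where "M = nat \<lfloor>sqrt 2 / z\<rfloor>"
  have V: "0 < V" unfolding V_def by (rule measure_ball_pos)
  have z: "0 < z" "z \<le> 1 / 5" using ab w d by (auto simp: z_def)
  have z2: "z\<^sup>2 = real CARD('d) * (b - a)\<^sup>2" by (simp add: z_def power_mult_distrib)
  note cub = floor_cubic_lower_bound[OF z, folded M_def]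
  \<comment> \<open>The dimension is at least 2, so \<open>z\<^sup>2 * M\<^sup>2 \<le> 2\<close>
    yields the hypothesis of \<open>slab_shift_bound\<close> on \<open>M\<close>.\<close>
  have "2 * ((b - a)\<^sup>2 * (real M)\<^sup>2) \<le> real CARD('d) * ((b - a)\<^sup>2 * (real M)\<^sup>2)"
    using d by (intro mult_right_mono) auto
  also have "\<dots> \<le> 2" using cub(2) by (simp add: z2 mult.assoc)
  finally have "(b - a)\<^sup>2 * real M ^ 2 \<le> 1" by simp
  from slab_shift_bound[OF P ab this d]
  have "measure lebesgue E * (real M - z\<^sup>2 * real M ^ 3 / 6) \<le> V"
    by (simp add: E_def V_def z2)
  then have "measure lebesgue E * (z * (real M - z\<^sup>2 * real M ^ 3 / 6)) \<le> V * z"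
    using z(1) by (simp add: mult.left_commute mult.commute mult_right_mono)
  moreover have "measure lebesgue E * (10 / 11) \<le> measure lebesgue E * (z * (real M - z\<^sup>2 * real M ^ 3 / 6))"
    using cub(1) by (intro mult_left_mono) auto
  ultimately have E_le: "measure lebesgue E \<le> (11 / 10) * z * V" by (simp add: algebra_simps)
  have "{u \<in> space borel. (\<exists>q\<in>P. a < q \<bullet> u) \<and> \<not> (\<exists>q\<in>P. b < q \<bullet> u)} \<in> sets (borel :: (real^'d) measure)"
    using P(1) by measurable
  then have "sphere 0 1 \<inter> {u \<in> space borel. (\<exists>q\<in>P. a < q \<bullet> u) \<and> \<not> (\<exists>q\<in>P. b < q \<bullet> u)}
      \<in> sets (borel :: (real^'d) measure)"
    by (intro sets.Int) auto
  also have "sphere 0 1 \<inter> {u \<in> space borel. (\<exists>q\<in>P. a < q \<bullet> u) \<and> \<not> (\<exists>q\<in>P. b < q \<bullet> u)} = B"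
    by (auto simp: B_def)
  finally have B: "B \<in> sets borel" "B \<subseteq> sphere 0 1" by (auto simp: B_def)
  have E_borel: "E \<in> sets borel"
    unfolding E_def using P(1) by measurable
  have cone: "x \<in> E" if x1: "x \<in> ball 0 1" and xB: "x /\<^sub>R norm x \<in> B" for x
  proof -
    have x: "0 < norm x" "norm x < 1" using x1 xB by (auto simp: B_def)
    obtain q where q: "q \<in> P" "a < q \<bullet> (x /\<^sub>R norm x)" using xB by (auto simp: B_def)
    have "norm x * a < q \<bullet> x" using q(2) x by (simp add: field_simps)
    moreover have "a \<le> norm x * a" using x ab(1) by (simp add: mult_le_cancel_right1)
    ultimately have "a < q \<bullet> x" by linarith
    moreover have "r \<bullet> x \<le> b" if "r \<in> P" for r
    proof -
      have "r \<bullet> (x /\<^sub>R norm x) \<le> b" using xB that by (auto simp: B_def not_less)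
      then have "r \<bullet> x \<le> norm x * b" using x by (simp add: field_simps)
      also have "\<dots> \<le> b" using x ab(2) by (simp add: mult_left_le_one_le)
      finally show ?thesis .
    qed
    ultimately show ?thesis using q(1) x1 by (auto simp: E_def not_less)
  qed
  have "emeasure uniform_sphere B =
      emeasure lborel {x \<in> ball 0 1. x /\<^sub>R norm x \<in> B} / emeasure lborel (ball (0::real^'d) 1)"
    by (rule emeasure_uniform_sphere[OF B])
  also have "\<dots> \<le> emeasure lborel E / emeasure lborel (ball (0::real^'d) 1)"
    using cone E_borel by (intro divide_right_mono_ennreal emeasure_mono) auto
  also have "\<dots> = ennreal (measure lebesgue E) / ennreal V"
  proof -
    have fin: "emeasure lborel (ball (0::real^'d) 1) < \<infinity>"
      by (rule emeasure_lborel_ball_finite)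
    have "emeasure lborel E \<le> emeasure lborel (ball (0::real^'d) 1)"
      by (rule emeasure_mono) (auto simp: E_def)
    then have "emeasure lborel E < \<infinity>" using fin by (rule le_less_trans)
    then show ?thesis using fin E_borel unfolding V_def
      by (simp add: emeasure_eq_ennreal_measure less_top)
  qed
  also have "\<dots> \<le> ennreal ((11 / 10) * z * V) / ennreal V"
    using E_le by (intro divide_right_mono_ennreal ennreal_leI)
  also have "\<dots> = ennreal ((11 / 10) * z)"
    using V z by (subst divide_ennreal) auto
  finally have "emeasure uniform_sphere B \<le> ennreal ((11 / 10) * z)" .
  moreover have "emeasure uniform_sphere B = ennreal (measure uniform_sphere B)"
    by (rule finite_measure.emeasure_eq_measure, rule prob_space.finite_measure, rule prob_space_uniform_sphere)
  ultimately have "measure uniform_sphere B \<le> (11 / 10) * z"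
    using z by simp
  then show ?thesis by (simp add: B_def z_def mult_ac)
qed

section \<open>Sign patterns of half-spaces\<close>

definition shatters :: "'a set set \<Rightarrow> 'a set \<Rightarrow> bool" where
  "shatters F Y \<longleftrightarrow> (\<forall>Z\<subseteq>Y. \<exists>T\<in>F. T \<inter> Y = Z)"

lemma shattersD: "shatters F Y \<Longrightarrow> Z \<subseteq> Y \<Longrightarrow> \<exists>T\<in>F. T \<inter> Y = Z"
  by (simp add: shatters_def)

lemma shatters_mono: "shatters F Y \<Longrightarrow> F \<subseteq> G \<Longrightarrow> shatters G Y"
  unfolding shatters_def by (meson subset_iff)

text \<open>Pajor's strengthening of the Sauer--Shelah lemma. Split \<open>F\<close> at
  \<open>x\<close> into \<open>A\<close> and \<open>B\<close>; a set shattered by both is counted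
  twice, which is paid for by the set itself and by the set with \<open>x\<close> added.\<close>

lemma card_le_card_shattered:
  assumes "finite X" "F \<subseteq> Pow X"
  shows "card F \<le> card {Y. Y \<subseteq> X \<and> shatters F Y}"
  using assms
proof (induction X arbitrary: F rule: finite_induct)
  case empty
  then have "F = {} \<or> F = {{}}" by auto
  then show ?case
  proof
    assume F: "F = {{}}"
    then have "{Y. Y \<subseteq> {} \<and> shatters F Y} = {{}}" by (auto simp: shatters_def)
    then show ?thesis using F by simp
  qed simp
next
  case (insert x X)
  define A where "A = {T \<in> F. x \<notin> T}"
  define B where "B = {T. x \<notin> T \<and> insert x T \<in> F}"
  define S where "S F = {Y. Y \<subseteq> X \<and> shatters F Y}" for F
  have AB: "A \<subseteq> Pow X" "B \<subseteq> Pow X" using insert.prems by (auto simp: A_def B_def)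
  have fin: "finite A" "finite B" "finite (S A)" "finite (S B)"
    using AB insert.hyps(1) by (auto intro: finite_subset[of _ "Pow X"] simp: S_def)
  have xS: "x \<notin> Y" if "Y \<in> S G" for Y G using that insert.hyps(2) by (auto simp: S_def)
  have F: "F = A \<union> insert x ` B"
  proof (intro set_eqI iffI)
    fix T assume T: "T \<in> F"
    show "T \<in> A \<union> insert x ` B"
    proof (cases "x \<in> T")
      case True
      then have "T = insert x (T - {x})" by auto
      moreover from this have "T - {x} \<in> B" using T by (simp add: B_def)
      ultimately show ?thesis by blast
    qed (use T in \<open>auto simp: A_def\<close>)
  qed (auto simp: A_def B_def)
  have "inj_on (insert x) B" by (rule inj_onI) (auto simp: B_def dest: insert_ident)
  then have "card F = card A + card B"
    unfolding F using fin by (subst card_Un_disjoint) (auto simp: card_image A_def)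
  also have "\<dots> \<le> card (S A) + card (S B)"
    unfolding S_def using insert.IH AB by (intro add_mono) auto
  also have "\<dots> = card (S A \<union> S B) + card (S A \<inter> S B)"
    using fin by (intro card_Un_Int) auto
  also have "card (S A \<inter> S B) = card (insert x ` (S A \<inter> S B))"
    using xS by (intro card_image[symmetric] inj_onI) (metis IntD1 insert_ident)
  also have "card (S A \<union> S B) + card (insert x ` (S A \<inter> S B)) =
      card ((S A \<union> S B) \<union> insert x ` (S A \<inter> S B))"
    using fin xS by (intro card_Un_disjoint[symmetric]) auto
  also have "\<dots> \<le> card {Y. Y \<subseteq> insert x X \<and> shatters F Y}"
  proof (rule card_mono)
    show "finite {Y. Y \<subseteq> insert x X \<and> shatters F Y}" using insert.hyps(1) by auto
    have "Y \<subseteq> X \<and> shatters F Y" if "Y \<in> S A" for Y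
      using that shatters_mono[of A Y F] by (auto simp: S_def A_def)
    moreover have "Y \<subseteq> X \<and> shatters F Y" if Y: "Y \<in> S B" for Y
    proof -
      have "\<exists>T\<in>F. T \<inter> Y = Z" if Z: "Z \<subseteq> Y" for Z
      proof -
        obtain T where "T \<in> B" "T \<inter> Y = Z" using Y shattersD[of B Y Z] Z by (auto simp: S_def)
        then have "insert x T \<in> F" "insert x T \<inter> Y = Z" using xS[OF Y] by (auto simp: B_def)
        then show ?thesis by blast
      qed
      then have "shatters F Y" unfolding shatters_def by blast
      then show ?thesis using Y by (simp add: S_def)
    qed
    \<comment> \<open>Subsets containing \<open>x\<close> are traced out through \<open>B\<close>,
      the others through \<open>A\<close>.\<close>
    moreover have "shatters F (insert x Y)" if Y: "Y \<in> S A" "Y \<in> S B" for Y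
      unfolding shatters_def
    proof (intro allI impI)
      fix Z assume Z: "Z \<subseteq> insert x Y"
      show "\<exists>T\<in>F. T \<inter> insert x Y = Z"
      proof (cases "x \<in> Z")
        case True
        have "Z - {x} \<subseteq> Y" using Z by auto
        then obtain T where "T \<in> B" "T \<inter> Y = Z - {x}"
          using Y(2) shattersD[of B Y "Z - {x}"] by (auto simp: S_def)
        then have "insert x T \<in> F" "insert x T \<inter> insert x Y = Z" using True by (auto simp: B_def)
        then show ?thesis by blast
      next
        case False
        then have "Z \<subseteq> Y" using Z by auto
        then obtain T where "T \<in> A" "T \<inter> Y = Z"
          using Y(1) shattersD[of A Y Z] by (auto simp: S_def)
        then have "T \<in> F" "T \<inter> insert x Y = Z" by (auto simp: A_def)
        then show ?thesis by blast
      qed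
    qed
    moreover have "insert x Y \<subseteq> insert x X" if "Y \<in> S A" for Y using that by (auto simp: S_def)
    ultimately show "(S A \<union> S B) \<union> insert x ` (S A \<inter> S B) \<subseteq> {Y. Y \<subseteq> insert x X \<and> shatters F Y}"
      by blast
  qed
  finally show ?case .
qed

text \<open>The relation is indexed, so repetitions count: \<open>a i - a j = 0\<close> is itself a
  relation when \<open>a\<close> is not injective, and otherwise dimension makes the image
  dependent.\<close>

lemma nontrivial_linear_relation:
  fixes a :: "'i \<Rightarrow> 'a::euclidean_space"
  assumes Y: "finite Y" "DIM('a) < card Y"
  shows "\<exists>c. (\<exists>i\<in>Y. c i \<noteq> 0) \<and> (\<Sum>i\<in>Y. c i *\<^sub>R a i) = 0"
proof (cases "inj_on a Y")
  case True
  then have "dependent (a ` Y)"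
    using Y by (intro dependent_biggerset) (auto simp: card_image)
  then obtain u where "\<exists>v\<in>a ` Y. u v \<noteq> 0" "(\<Sum>v\<in>a ` Y. u v *\<^sub>R v) = 0"
    using Y(1) by (auto simp: dependent_finite)
  then show ?thesis
    using True by (intro exI[of _ "u \<circ> a"]) (auto simp: sum.reindex)
next
  case False
  then obtain i j where ij: "i \<in> Y" "j \<in> Y" "i \<noteq> j" "a i = a j" by (auto simp: inj_on_def)
  define c :: "'i \<Rightarrow> real" where "c k = (if k = i then 1 else if k = j then -1 else 0)" for k
  have "(\<Sum>k\<in>Y. c k *\<^sub>R a k) = (\<Sum>k\<in>{i, j}. c k *\<^sub>R a k)"
    using ij Y(1) by (intro sum.mono_neutral_right) (auto simp: c_def)
  also have "\<dots> = 0" using ij by (simp add: c_def)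
  finally show ?thesis using ij by (intro exI[of _ c]) (auto simp: c_def)
qed

text \<open>If \<open>Y\<close> were larger, its vectors would satisfy a linear relation, and
  shattering would provide a \<open>p\<close> whose signs follow those of the coefficients. Pairing
  the relation with \<open>p\<close> gives a positive number equal to 0.\<close>

lemma card_shattered_by_halfspaces:
  fixes a :: "'i \<Rightarrow> 'a::euclidean_space"
  assumes Y: "finite Y" "Y \<subseteq> I"
    and sh: "shatters {T. \<exists>p\<in>D. T = {i \<in> I. 0 < p \<bullet> a i} \<and> (\<forall>i\<in>I. p \<bullet> a i \<noteq> 0)} Y"
  shows "card Y \<le> DIM('a)"
proof (rule ccontr)
  assume "\<not> card Y \<le> DIM('a)"
  then obtain c0 where c0: "\<exists>i\<in>Y. c0 i \<noteq> 0" "(\<Sum>i\<in>Y. c0 i *\<^sub>R a i) = 0"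
    using nontrivial_linear_relation[OF Y(1), of a] by (auto simp: not_le)
  \<comment> \<open>Negating if necessary ensures a positive coefficient, hence a strictly positive
    term in the pairing.\<close>
  define c where "c = (if \<exists>i\<in>Y. 0 < c0 i then c0 else (\<lambda>i. - c0 i))"
  have c: "\<exists>i\<in>Y. 0 < c i" "(\<Sum>i\<in>Y. c i *\<^sub>R a i) = 0"
    using c0 by (auto simp: c_def sum_negf) (metis linorder_neqE_linordered_idom)
  obtain p where p: "{i \<in> I. 0 < p \<bullet> a i} \<inter> Y = {i \<in> Y. 0 < c i}" "\<forall>i\<in>I. p \<bullet> a i \<noteq> 0"
    using sh[unfolded shatters_def, rule_format, of "{i \<in> Y. 0 < c i}"] by auto
  have sgn: "0 < p \<bullet> a i \<longleftrightarrow> 0 < c i" "p \<bullet> a i \<noteq> 0" if "i \<in> Y" for i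
    using p that Y(2) by auto
  have nonneg: "0 \<le> c i * (p \<bullet> a i)" if "i \<in> Y" for i
    using sgn[OF that] by (cases "0 < c i") (auto simp: not_less intro: mult_nonpos_nonpos)
  obtain k where k: "k \<in> Y" "0 < c k" using c by auto
  have "0 < c k * (p \<bullet> a k)" using sgn[OF k(1)] k by auto
  also have "\<dots> \<le> (\<Sum>i\<in>Y. c i * (p \<bullet> a i))"
    using nonneg by (intro member_le_sum[OF k(1) _ Y(1)]) auto
  also have "\<dots> = p \<bullet> (\<Sum>i\<in>Y. c i *\<^sub>R a i)" by (simp add: inner_sum_right)
  finally show False using c by simp
qed

lemma card_subsets_le:
  assumes "finite I"
  shows "card {Y. Y \<subseteq> I \<and> card Y \<le> d} = (\<Sum>k\<le>d. card I choose k)"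
proof -
  have "{Y. Y \<subseteq> I \<and> card Y \<le> d} = (\<Union>k\<le>d. {Y. Y \<subseteq> I \<and> card Y = k})" by auto
  also have "card \<dots> = (\<Sum>k\<le>d. card {Y. Y \<subseteq> I \<and> card Y = k})"
    using assms by (intro card_UN_disjoint) auto
  finally show ?thesis using n_subsets[OF assms] by simp
qed

lemma card_sign_patterns:
  fixes a :: "'i \<Rightarrow> 'a::euclidean_space"
  assumes I: "finite I"
  shows "card {T. \<exists>p\<in>D. T = {i \<in> I. 0 < p \<bullet> a i} \<and> (\<forall>i\<in>I. p \<bullet> a i \<noteq> 0)}
    \<le> (\<Sum>k\<le>DIM('a). card I choose k)" (is "card ?F \<le> _")
proof -
  have "card ?F \<le> card {Y. Y \<subseteq> I \<and> shatters ?F Y}"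
    using I by (intro card_le_card_shattered) auto
  also have "\<dots> \<le> card {Y. Y \<subseteq> I \<and> card Y \<le> DIM('a)}"
    using I by (intro card_mono) (auto intro: card_shattered_by_halfspaces finite_subset)
  finally show ?thesis by (simp add: card_subsets_le[OF I])
qed

text \<open>A Chernoff argument: for \<open>k \<le> d\<close> the weight \<open>x ^ k\<close> is at
  least \<open>x ^ d\<close>, and \<open>x = 1 / 4\<close> minimises
  \<open>(1 + x) ^ 5 / x\<close>.\<close>

lemma sum_binomial_lower_tail:
  "real (\<Sum>k\<le>d. (5 * d) choose k) \<le> (4 * (5 / 4) ^ 5) ^ d"
proof -
  have "real (\<Sum>k\<le>d. (5 * d) choose k) / 4 ^ d = (\<Sum>k\<le>d. real ((5 * d) choose k) * (1 / 4) ^ d)"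
    by (simp add: sum_divide_distrib power_divide)
  also have "\<dots> \<le> (\<Sum>k\<le>d. real ((5 * d) choose k) * (1 / 4) ^ k)"
    by (intro sum_mono mult_left_mono power_decreasing) auto
  also have "\<dots> \<le> (\<Sum>k\<le>5 * d. real ((5 * d) choose k) * (1 / 4) ^ k)"
    by (intro sum_mono2) auto
  also have "\<dots> = (5 / 4) ^ (5 * d)"
    using binomial_ring[of "1 / 4" "1 :: real" "5 * d"] by simp
  finally have "real (\<Sum>k\<le>d. (5 * d) choose k) \<le> (5 / 4) ^ (5 * d) * 4 ^ d"
    by (simp add: pos_divide_le_eq)
  also have "\<dots> = (4 * (5 / 4) ^ 5) ^ d"
    by (simp add: power_mult power_mult_distrib)
  finally show ?thesis .
qed

section \<open>Feasibility with thresholds\<close>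

text \<open>Restricting the cap centres to a countable \<open>D\<close> makes the event measurable.
  The thresholds depend on the row so that they can be changed one at a time.\<close>

definition feasible_set :: "(real^'d) set \<Rightarrow> nat set \<Rightarrow> (nat \<Rightarrow> real) \<Rightarrow> (nat \<Rightarrow> real^'d) set" where
  "feasible_set D I \<theta> = {A \<in> space (\<Pi>\<^sub>M i\<in>I. uniform_sphere). \<exists>p\<in>D. \<forall>i\<in>I. \<theta> i < p \<bullet> A i}"

definition feas_prob :: "(real^'d) set \<Rightarrow> nat set \<Rightarrow> (nat \<Rightarrow> real) \<Rightarrow> real" where
  "feas_prob D I \<theta> = measure (\<Pi>\<^sub>M i\<in>I. uniform_sphere) (feasible_set D I \<theta>)"

interpretation uniform_sphere: product_sigma_finite "\<lambda>_::nat. uniform_sphere :: (real^'d) measure"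
  by (rule product_sigma_finite.intro) (rule prob_space_imp_sigma_finite, rule prob_space_uniform_sphere)

lemma prob_space_PiM_uniform_sphere: "prob_space (\<Pi>\<^sub>M i\<in>I. (uniform_sphere :: (real^'d) measure))"
  by (intro prob_space_PiM prob_space_uniform_sphere)

lemma borel_measurable_uniform_sphere:
  "f \<in> borel_measurable borel \<Longrightarrow> f \<in> borel_measurable (uniform_sphere :: (real^'d) measure)"
  using measurable_restrict_space1[of f borel borel "sphere 0 1"]
  unfolding measurable_cong_sets[OF sets_uniform_sphere refl] .

lemma measurable_row [measurable]:
  assumes "i \<in> I"
  shows "(\<lambda>A. A i) \<in> borel_measurable (\<Pi>\<^sub>M i\<in>I. (uniform_sphere :: (real^'d) measure))"
proof -
  have "(\<lambda>x. x) \<circ> (\<lambda>A. A i) \<in> borel_measurable (\<Pi>\<^sub>M i\<in>I. (uniform_sphere :: (real^'d) measure))"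
    using assms by (intro measurable_comp[OF measurable_component_singleton] borel_measurable_uniform_sphere) auto
  then show ?thesis by (simp add: comp_def)
qed

lemma sets_feasible_set [measurable]:
  assumes "countable D" "finite I"
  shows "feasible_set D I \<theta> \<in> sets (\<Pi>\<^sub>M i\<in>I. (uniform_sphere :: (real^'d) measure))"
proof -
  let ?M = "\<Pi>\<^sub>M i\<in>I. (uniform_sphere :: (real^'d) measure)"
  have "{A \<in> space ?M. \<theta> i < p \<bullet> A i} \<in> sets ?M" if "i \<in> I" for p i
    using that by (intro borel_measurable_less borel_measurable_inner borel_measurable_const measurable_row)
  then show ?thesis
    unfolding feasible_set_def using assms
    by (intro sets.sets_Collect_countable_Ex' sets.sets_Collect_finite_All) auto
qed

lemma emeasure_feasible_set:
  "emeasure (\<Pi>\<^sub>M i\<in>I. uniform_sphere) (feasible_set D I \<theta>) = ennreal (feas_prob D I \<theta>)"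
  unfolding feas_prob_def
  by (rule finite_measure.emeasure_eq_measure, rule prob_space.finite_measure, rule prob_space_PiM_uniform_sphere)

lemma feas_prob_nonneg [simp]: "0 \<le> feas_prob D I \<theta>"
  by (simp add: feas_prob_def)

lemma feas_prob_le_1: "feas_prob D I \<theta> \<le> 1"
  unfolding feas_prob_def by (rule prob_space.prob_le_1[OF prob_space_PiM_uniform_sphere])

lemma feas_prob_mono:
  assumes "countable D" "finite I" "D' \<subseteq> D" "\<And>i. i \<in> I \<Longrightarrow> \<theta> i \<le> \<theta>' i"
  shows "feas_prob D' I \<theta>' \<le> feas_prob D I \<theta>"
  unfolding feas_prob_def
proof (rule finite_measure.finite_measure_mono[OF prob_space.finite_measure[OF prob_space_PiM_uniform_sphere]])
  show "feasible_set D' I \<theta>' \<subseteq> feasible_set D I \<theta>"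
    unfolding feasible_set_def using assms(3,4) by (blast intro: le_less_trans)
qed (use assms in measurable)

lemma feas_prob_cong: "(\<And>i. i \<in> I \<Longrightarrow> \<theta> i = \<theta>' i) \<Longrightarrow> feas_prob D I \<theta> = feas_prob D I \<theta>'"
  unfolding feas_prob_def feasible_set_def by simp

lemma feas_prob_lower_one:
  fixes D :: "(real^'d) set" and a b :: real
  assumes D: "finite D" "D \<subseteq> sphere 0 1" and I: "finite I" "i \<notin> I" and ab: "a < 0" "0 \<le> b" "a + b \<le> 0"
    and w: "(b - a) * sqrt (real CARD('d)) \<le> 1 / 5" and d: "2 \<le> CARD('d)"
  shows "feas_prob D (insert i I) (\<theta>(i := a)) \<le>
    feas_prob D (insert i I) (\<theta>(i := b)) + (11 / 10) * sqrt (real CARD('d)) * (b - a) * feas_prob D I \<theta>"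
proof -
  let ?M = "\<Pi>\<^sub>M i\<in>insert i I. (uniform_sphere :: (real^'d) measure)"
  let ?N = "\<Pi>\<^sub>M i\<in>I. (uniform_sphere :: (real^'d) measure)"
  define \<beta> where "\<beta> = (11 / 10) * sqrt (real CARD('d)) * (b - a)"
  define Ga where "Ga = feasible_set D (insert i I) (\<theta>(i := a))"
  define Gb where "Gb = feasible_set D (insert i I) (\<theta>(i := b))"
  have \<beta>: "0 \<le> \<beta>" using ab by (simp add: \<beta>_def)
  have G [measurable]: "Ga \<in> sets ?M" "Gb \<in> sets ?M"
    unfolding Ga_def Gb_def using D I by (simp_all only: sets_feasible_set countable_finite finite_insert)
  have "emeasure ?M Ga \<le> emeasure ?M (Gb \<union> (Ga - Gb))"
    by (intro emeasure_mono) auto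
  also have "\<dots> \<le> emeasure ?M Gb + emeasure ?M (Ga - Gb)"
    by (intro emeasure_subadditive) auto
  also have "emeasure ?M (Ga - Gb) = (\<integral>\<^sup>+A. \<integral>\<^sup>+y. indicator (Ga - Gb) (A(i := y)) \<partial>uniform_sphere \<partial>?N)"
    using uniform_sphere.product_nn_integral_insert[OF I, of "indicator (Ga - Gb)"] by simp
  also have "\<dots> \<le> (\<integral>\<^sup>+A. ennreal \<beta> * indicator (feasible_set D I \<theta>) A \<partial>?N)"
  proof (rule nn_integral_mono)
    fix A assume A: "A \<in> space ?N"
    define P where "P = {p \<in> D. \<forall>j\<in>I. \<theta> j < p \<bullet> A j}"
    define B where "B = {u \<in> sphere 0 1. (\<exists>q\<in>P. a < q \<bullet> u) \<and> \<not> (\<exists>q\<in>P. b < q \<bullet> u)}"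
    have sub: "y \<in> B" if "y \<in> sphere 0 1" "A(i := y) \<in> Ga - Gb" for y
    proof -
      have upd: "(\<forall>j\<in>insert i I. (\<theta>(i := c)) j < p \<bullet> (A(i := y)) j) \<longleftrightarrow> c < p \<bullet> y \<and> (\<forall>j\<in>I. \<theta> j < p \<bullet> A j)"
        for p c
        using I(2) by (auto simp del: fun_upd_apply simp: fun_upd_same) (metis fun_upd_other)+
      from that(2) have "\<exists>p\<in>D. a < p \<bullet> y \<and> (\<forall>j\<in>I. \<theta> j < p \<bullet> A j)"
        "\<not> (\<exists>p\<in>D. b < p \<bullet> y \<and> (\<forall>j\<in>I. \<theta> j < p \<bullet> A j))"
        unfolding Ga_def Gb_def feasible_set_def by (simp_all only: Diff_iff mem_Collect_eq upd) blast+
      then show ?thesis using that(1) unfolding B_def P_def by blast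
    qed
    show "(\<integral>\<^sup>+y. indicator (Ga - Gb) (A(i := y)) \<partial>uniform_sphere) \<le> ennreal \<beta> * indicator (feasible_set D I \<theta>) A"
    proof (cases "P = {}")
      case True
      then have "B = {}" by (auto simp: B_def)
      then have "(\<integral>\<^sup>+y. indicator (Ga - Gb) (A(i := y)) \<partial>(uniform_sphere :: (real^'d) measure)) =
          (\<integral>\<^sup>+y. 0 \<partial>(uniform_sphere :: (real^'d) measure))"
        using sub by (intro nn_integral_cong) (auto simp: indicator_def)
      then show ?thesis by simp
    next
      case False
      then have AF: "A \<in> feasible_set D I \<theta>" using A unfolding feasible_set_def P_def by blast
      have P: "finite P" "P \<subseteq> sphere 0 1" using D by (auto simp: P_def)
      have "{u \<in> space uniform_sphere. (\<exists>q\<in>P. a < q \<bullet> u) \<and> \<not> (\<exists>q\<in>P. b < q \<bullet> u)} \<in> sets (uniform_sphere :: (real^'d) measure)"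
        using P(1) by (intro sets.sets_Collect_conj sets.sets_Collect_neg sets.sets_Collect_finite_Ex
            borel_measurable_less borel_measurable_const borel_measurable_uniform_sphere) auto
      then have B: "B \<in> sets uniform_sphere" by (simp add: B_def)
      have "(\<integral>\<^sup>+y. indicator (Ga - Gb) (A(i := y)) \<partial>(uniform_sphere :: (real^'d) measure)) \<le>
          (\<integral>\<^sup>+y. indicator B y \<partial>uniform_sphere)"
        using sub by (intro nn_integral_mono) (auto simp: indicator_def)
      also have "\<dots> = ennreal (measure uniform_sphere B)"
        using B by (simp, intro finite_measure.emeasure_eq_measure prob_space.finite_measure prob_space_uniform_sphere)
      also have "\<dots> \<le> ennreal \<beta>"
        unfolding B_def \<beta>_def by (intro ennreal_leI uniform_sphere_slab_bound P False ab w d)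
      finally show ?thesis using AF by simp
    qed
  qed
  also have "\<dots> = ennreal \<beta> * emeasure ?N (feasible_set D I \<theta>)"
    by (rule nn_integral_cmult_indicator[OF sets_feasible_set[OF countable_finite[OF D(1)] I(1)]])
  finally have "ennreal (feas_prob D (insert i I) (\<theta>(i := a))) \<le>
      ennreal (feas_prob D (insert i I) (\<theta>(i := b)) + \<beta> * feas_prob D I \<theta>)"
    unfolding Ga_def Gb_def emeasure_feasible_set using \<beta> by (simp add: ennreal_plus ennreal_mult)
  then have "feas_prob D (insert i I) (\<theta>(i := a)) \<le> feas_prob D (insert i I) (\<theta>(i := b)) + \<beta> * feas_prob D I \<theta>"
    using \<beta> by (subst (asm) ennreal_le_iff) auto
  then show ?thesis by (simp only: \<beta>_def)
qed

text \<open>A centre serving all rows serves each group, and disjoint groups of rows are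
  independent.\<close>

lemma feas_prob_Un:
  fixes D :: "(real^'d) set"
  assumes D: "countable D" and I: "finite I" "finite J" "I \<inter> J = {}"
  shows "feas_prob D (I \<union> J) \<theta> \<le> feas_prob D I \<theta> * feas_prob D J \<theta>"
proof -
  let ?M = "\<lambda>I. \<Pi>\<^sub>M i\<in>I. (uniform_sphere :: (real^'d) measure)"
  have F [measurable]: "feasible_set D K \<theta> \<in> sets (?M K)" if "finite K" for K
    using that D by auto
  have "emeasure (?M (I \<union> J)) (feasible_set D (I \<union> J) \<theta>) =
      (\<integral>\<^sup>+x. \<integral>\<^sup>+y. indicator (feasible_set D (I \<union> J) \<theta>) (merge I J (x, y)) \<partial>?M J \<partial>?M I)"
    using I F[of "I \<union> J"] uniform_sphere.product_nn_integral_fold[OF I(3,1,2), of "indicator (feasible_set D (I \<union> J) \<theta>)"]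
    by simp
  also have "\<dots> \<le> (\<integral>\<^sup>+x. \<integral>\<^sup>+y. indicator (feasible_set D I \<theta>) x * indicator (feasible_set D J \<theta>) y \<partial>?M J \<partial>?M I)"
  proof (intro nn_integral_mono)
    fix x y assume xy: "x \<in> space (?M I)" "y \<in> space (?M J)"
    have "x \<in> feasible_set D I \<theta> \<and> y \<in> feasible_set D J \<theta>" if mrg: "merge I J (x, y) \<in> feasible_set D (I \<union> J) \<theta>"
    proof -
      obtain p where p: "p \<in> D" "\<forall>i\<in>I \<union> J. \<theta> i < p \<bullet> merge I J (x, y) i"
        using mrg by (auto simp: feasible_set_def)
      have "\<theta> i < p \<bullet> x i" if "i \<in> I" for i using bspec[OF p(2), of i] that by (simp add: merge_def)
      moreover have "\<theta> i < p \<bullet> y i" if "i \<in> J" for i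
      proof -
        have "i \<notin> I" using that I(3) by auto
        then show ?thesis using bspec[OF p(2), of i] that by (simp add: merge_def)
      qed
      ultimately show ?thesis using p(1) xy unfolding feasible_set_def by blast
    qed
    then show "indicator (feasible_set D (I \<union> J) \<theta>) (merge I J (x, y)) \<le>
        (indicator (feasible_set D I \<theta>) x * indicator (feasible_set D J \<theta>) y :: ennreal)"
      by (auto simp: indicator_def)
  qed
  also have "\<dots> = emeasure (?M I) (feasible_set D I \<theta>) * emeasure (?M J) (feasible_set D J \<theta>)"
    using F[OF I(1)] F[OF I(2)] by (simp add: nn_integral_cmult nn_integral_multc)
  finally have "ennreal (feas_prob D (I \<union> J) \<theta>) \<le> ennreal (feas_prob D I \<theta> * feas_prob D J \<theta>)"
    unfolding emeasure_feasible_set by (simp add: ennreal_mult)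
  then show ?thesis by simp
qed

section \<open>Symmetry under sign changes of the rows\<close>

lemma distr_flip_rows:
  fixes T :: "nat set"
  assumes I: "finite I"
  defines "M \<equiv> \<Pi>\<^sub>M i\<in>I. (uniform_sphere :: (real^'d) measure)"
  defines "flip \<equiv> (\<lambda>A. \<lambda>i\<in>I. if i \<in> T then - A i else A i)"
  shows "flip \<in> measurable M M" "distr M M flip = M"
proof -
  have neg_inv: "distr uniform_sphere uniform_sphere uminus = (uniform_sphere :: (real^'d) measure)"
    by (rule uniform_sphere_orthogonal_invariant) (simp add: orthogonal_transformation_def linear_uminus)
  have "uminus \<in> measurable (restrict_space borel (sphere 0 1)) (restrict_space borel (sphere (0::real^'d) 1))"
    by (intro measurable_restrict_space3) auto
  then have neg [measurable]: "uminus \<in> measurable uniform_sphere (uniform_sphere :: (real^'d) measure)"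
    by (simp add: measurable_cong_sets[OF sets_uniform_sphere sets_uniform_sphere])
  have comp: "(\<lambda>A. if i \<in> T then - A i else A i) \<in> measurable M uniform_sphere" if "i \<in> I" for i
    using that measurable_compose[OF measurable_component_singleton[OF that, of "\<lambda>_. uniform_sphere :: (real^'d) measure"] neg]
      measurable_component_singleton[OF that, of "\<lambda>_. uniform_sphere :: (real^'d) measure"]
    by (auto simp: M_def)
  show meas: "flip \<in> measurable M M"
    unfolding flip_def using comp unfolding M_def by (intro measurable_restrict) auto
  show "distr M M flip = M"
    unfolding M_def
  proof (rule uniform_sphere.PiM_eqI[OF I])
    fix E assume E: "\<And>i. i \<in> I \<Longrightarrow> E i \<in> sets (uniform_sphere :: (real^'d) measure)"
    \<comment> \<open>The two measures are compared on boxes; the preimage of a box is the box with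
      the sides in \<open>T\<close> reflected.\<close>
    define E' where "E' i = (if i \<in> T then uminus -` E i \<inter> space uniform_sphere else E i)" for i
    have E': "E' i \<in> sets uniform_sphere" "emeasure uniform_sphere (E' i) = emeasure uniform_sphere (E i)" if "i \<in> I" for i
    proof -
      show "E' i \<in> sets uniform_sphere" using E[OF that] measurable_sets[OF neg, of "E i"] by (auto simp: E'_def)
      have "emeasure uniform_sphere (uminus -` E i \<inter> space uniform_sphere) =
          emeasure (distr uniform_sphere uniform_sphere uminus) (E i)"
        using E[OF that] by (simp add: emeasure_distr)
      then show "emeasure uniform_sphere (E' i) = emeasure uniform_sphere (E i)"
        by (simp add: E'_def neg_inv)
    qed
    have sp: "E i \<subseteq> sphere 0 1" if "i \<in> I" for i using sets.sets_into_space[OF E[OF that]] by simp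
    have "flip -` (Pi\<^sub>E I E) \<inter> space M = Pi\<^sub>E I E'"
    proof (intro set_eqI iffI)
      fix A assume A: "A \<in> flip -` (Pi\<^sub>E I E) \<inter> space M"
      show "A \<in> Pi\<^sub>E I E'"
      proof (rule PiE_I)
        fix i assume i: "i \<in> I"
        have "flip A i \<in> E i" "A i \<in> sphere 0 1" using A i by (auto simp: M_def space_PiM PiE_iff)
        then show "A i \<in> E' i" using i by (auto simp: flip_def E'_def split: if_splits)
      next
        fix i assume "i \<notin> I"
        then show "A i = undefined" using A by (auto simp: M_def space_PiM PiE_iff extensional_def)
      qed
    next
      fix A assume A: "A \<in> Pi\<^sub>E I E'"
      have "A i \<in> E' i" if "i \<in> I" for i using A that by auto
      then have "flip A i \<in> E i" "A i \<in> sphere 0 1" if "i \<in> I" for i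
        using that sp[OF that] by (fastforce simp: flip_def E'_def split: if_splits)+
      then show "A \<in> flip -` (Pi\<^sub>E I E) \<inter> space M"
        using A by (auto simp: M_def space_PiM PiE_iff flip_def)
    qed
    then have "emeasure (distr M M flip) (Pi\<^sub>E I E) = emeasure M (Pi\<^sub>E I E')"
      using E I meas by (subst emeasure_distr) (auto simp: M_def intro!: sets_PiM_I_finite)
    also have "\<dots> = (\<Prod>i\<in>I. emeasure uniform_sphere (E' i))"
      unfolding M_def using E' I by (intro uniform_sphere.emeasure_PiM) auto
    finally show "emeasure (distr (\<Pi>\<^sub>M i\<in>I. uniform_sphere) (\<Pi>\<^sub>M i\<in>I. uniform_sphere) flip) (Pi\<^sub>E I E) =
        (\<Prod>i\<in>I. emeasure uniform_sphere (E i))"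
      using E' by (simp add: M_def)
  qed simp
qed

text \<open>Wendel's symmetrisation. Every flip preserves the law, so the probability equals its
  average over all flips; for fixed rows the flips that become feasible correspond to sign patterns,
  and those are few.\<close>

lemma feas_prob_zero_le:
  fixes D :: "(real^'d) set"
  assumes D: "countable D" and I: "finite I"
  shows "feas_prob D I (\<lambda>_. 0) \<le> real (\<Sum>k\<le>CARD('d). card I choose k) / 2 ^ card I"
proof -
  define M where "M = (\<Pi>\<^sub>M i\<in>I. (uniform_sphere :: (real^'d) measure))"
  define flip :: "nat set \<Rightarrow> (nat \<Rightarrow> real^'d) \<Rightarrow> (nat \<Rightarrow> real^'d)"
    where "flip T = (\<lambda>A. \<lambda>i\<in>I. if i \<in> T then - A i else A i)" for T
  define G where "G = feasible_set D I (\<lambda>_. 0)"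
  define S where "S = (\<Sum>k\<le>CARD('d). card I choose k)"
  have G [measurable]: "G \<in> sets M" unfolding G_def M_def using D I by simp
  have flip [measurable]: "flip T \<in> measurable M M" and distr_flip: "distr M M (flip T) = M" for T
    using distr_flip_rows[OF I, of T] by (auto simp: M_def flip_def)
  have "of_nat (2 ^ card I) * emeasure M G = (\<Sum>T\<in>Pow I. emeasure (distr M M (flip T)) G)"
    using I by (simp add: distr_flip card_Pow)
  also have "\<dots> = (\<Sum>T\<in>Pow I. \<integral>\<^sup>+A. indicator G (flip T A) \<partial>M)"
    using nn_integral_distr[OF flip, of "indicator G"] by (intro sum.cong refl) (simp add: distr_flip)
  also have "\<dots> = (\<integral>\<^sup>+A. (\<Sum>T\<in>Pow I. indicator G (flip T A)) \<partial>M)"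
    by (intro nn_integral_sum[symmetric]) measurable
  also have "\<dots> \<le> (\<integral>\<^sup>+A. of_nat S \<partial>M)"
  proof (rule nn_integral_mono)
    fix A assume "A \<in> space M"
    \<comment> \<open>A flip made feasible by \<open>p\<close> reverses exactly the rows with
      \<open>p \<bullet> A i < 0\<close>; for \<open>- A i\<close> these are the positive ones, as
      \<open>card_sign_patterns\<close> expects.\<close>
    have "{T \<in> Pow I. flip T A \<in> G} \<subseteq>
        {T. \<exists>p\<in>D. T = {i \<in> I. 0 < p \<bullet> - A i} \<and> (\<forall>i\<in>I. p \<bullet> - A i \<noteq> 0)}"
    proof (rule subsetI, clarify)
      fix T assume T: "T \<subseteq> I" "flip T A \<in> G"
      then obtain p where p: "p \<in> D" "\<forall>i\<in>I. 0 < p \<bullet> flip T A i" by (auto simp: G_def feasible_set_def)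
      have "i \<in> T \<and> p \<bullet> A i < 0 \<or> i \<notin> T \<and> 0 < p \<bullet> A i" if "i \<in> I" for i
        using bspec[OF p(2) that] that by (auto simp: flip_def split: if_splits)
      then have "T = {i \<in> I. 0 < p \<bullet> - A i} \<and> (\<forall>i\<in>I. p \<bullet> - A i \<noteq> 0)" using T(1) by fastforce
      then show "\<exists>p\<in>D. T = {i \<in> I. 0 < p \<bullet> - A i} \<and> (\<forall>i\<in>I. p \<bullet> - A i \<noteq> 0)" using p(1) by blast
    qed
    then have "card {T \<in> Pow I. flip T A \<in> G} \<le>
        card {T. \<exists>p\<in>D. T = {i \<in> I. 0 < p \<bullet> - A i} \<and> (\<forall>i\<in>I. p \<bullet> - A i \<noteq> 0)}"
      using I by (intro card_mono) (auto intro: finite_subset[of _ "Pow I"])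
    also have "\<dots> \<le> S" using card_sign_patterns[OF I, of D "\<lambda>i. - A i"] by (simp add: S_def)
    finally have "card {T \<in> Pow I. flip T A \<in> G} \<le> S" .
    moreover have "(\<Sum>T\<in>Pow I. indicator G (flip T A)) = (of_nat (card {T \<in> Pow I. flip T A \<in> G}) :: ennreal)"
      using I by (simp add: indicator_def sum.If_cases Int_def)
    ultimately show "(\<Sum>T\<in>Pow I. indicator G (flip T A)) \<le> (of_nat S :: ennreal)" by simp
  qed
  also have "\<dots> = of_nat S"
    using prob_space.emeasure_space_1[OF prob_space_PiM_uniform_sphere[of I, where 'd='d]] by (simp add: M_def)
  finally have "ennreal (2 ^ card I * feas_prob D I (\<lambda>_. 0)) \<le> ennreal (real S)"
    unfolding M_def G_def emeasure_feasible_set by (simp add: ennreal_mult ennreal_of_nat_eq_real_of_nat)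
  then have "2 ^ card I * feas_prob D I (\<lambda>_. 0) \<le> real S" by simp
  then show ?thesis by (simp add: S_def field_simps)
qed

section \<open>Window estimate, uniform in the number of rows\<close>

lemma feas_prob_telescope:
  fixes D :: "(real^'d) set" and a b :: real
  assumes D: "finite D" "D \<subseteq> sphere 0 1" and I: "finite I" and ab: "a < 0" "0 \<le> b" "a + b \<le> 0"
    and w: "(b - a) * sqrt (real CARD('d)) \<le> 1 / 5" and d: "2 \<le> CARD('d)"
    and q: "\<And>i. i \<in> I \<Longrightarrow> feas_prob D (I - {i}) (\<lambda>_. a) \<le> q"
  shows "feas_prob D I (\<lambda>_. a) \<le>
    feas_prob D I (\<lambda>_. b) + real (card I) * ((11 / 10) * sqrt (real CARD('d)) * (b - a) * q)"
proof -
  define \<beta> where "\<beta> = (11 / 10) * sqrt (real CARD('d)) * (b - a)"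
  have \<beta>: "0 \<le> \<beta>" using ab by (simp add: \<beta>_def)
  \<comment> \<open>\<open>K\<close> collects the rows already raised to \<open>b\<close>. The
    remaining thresholds are always at least \<open>a\<close>, so \<open>q\<close> bounds the
    feasibility of the other rows at every step.\<close>
  have "feas_prob D I (\<lambda>_. a) \<le> feas_prob D I (\<lambda>i. if i \<in> K then b else a) + real (card K) * (\<beta> * q)"
    if "finite K" "K \<subseteq> I" for K
    using that
  proof (induction K rule: finite_induct)
    case (insert k K)
    define \<theta> where "\<theta> = (\<lambda>i. if i \<in> K then b else a)"
    have k: "k \<in> I" "insert k (I - {k}) = I" using insert.prems by auto
    have ta: "\<theta>(k := a) = \<theta>" using insert.hyps by (auto simp: \<theta>_def)
    have tb: "\<theta>(k := b) = (\<lambda>i. if i \<in> insert k K then b else a)" by (auto simp: \<theta>_def)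
    have "feas_prob D I \<theta> \<le> feas_prob D I (\<theta>(k := b)) + \<beta> * feas_prob D (I - {k}) \<theta>"
      using feas_prob_lower_one[OF D, of "I - {k}" k a b \<theta>, unfolded k(2) ta] I ab w d
      by (simp only: \<beta>_def finite_Diff) simp
    moreover have "feas_prob D (I - {k}) \<theta> \<le> feas_prob D (I - {k}) (\<lambda>_. a)"
      using ab D I by (intro feas_prob_mono) (auto simp: \<theta>_def countable_finite)
    then have "\<beta> * feas_prob D (I - {k}) \<theta> \<le> \<beta> * q"
      using q[OF k(1)] \<beta> by (intro mult_left_mono) auto
    moreover have "feas_prob D I (\<lambda>_. a) \<le> feas_prob D I \<theta> + real (card K) * (\<beta> * q)"
      using insert by (auto simp: \<theta>_def)
    ultimately have "feas_prob D I (\<lambda>_. a) \<le> feas_prob D I (\<theta>(k := b)) + \<beta> * q + real (card K) * (\<beta> * q)"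
      by linarith
    then show ?case using insert.hyps unfolding tb by (simp add: algebra_simps)
  qed simp
  from this[OF I order_refl] feas_prob_cong[of I "\<lambda>i. if i \<in> I then b else a" "\<lambda>_. b" D]
  show ?thesis by (simp add: \<beta>_def mult_ac)
qed

text \<open>Blocks of \<open>N\<close> rows are split off one by one; leftover rows contribute a
  factor of at most 1.\<close>

lemma feas_prob_blocks:
  fixes D :: "(real^'d) set"
  assumes D: "countable D" and q: "\<And>J. finite J \<Longrightarrow> card J = N \<Longrightarrow> feas_prob D J \<theta> \<le> q"
    and "finite J" "k * N \<le> card J"
  shows "feas_prob D J \<theta> \<le> q ^ k"
  using assms(3,4)
proof (induction k arbitrary: J)
  case 0
  then show ?case by (simp add: feas_prob_le_1)
next
  case (Suc k)
  obtain J' where J': "J' \<subseteq> J" "card J' = N" "finite J'"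
    using obtain_subset_with_card_n[of N J] Suc.prems by auto
  have "card (J - J') = card J - N" using J' by (simp add: card_Diff_subset)
  then have "feas_prob D (J - J') \<theta> \<le> q ^ k" using Suc by simp
  moreover have "feas_prob D J' \<theta> \<le> q" using q J' by simp
  moreover from this have "0 \<le> q" using feas_prob_nonneg order_trans by blast
  moreover have "feas_prob D (J' \<union> (J - J')) \<theta> \<le> feas_prob D J' \<theta> * feas_prob D (J - J') \<theta>"
    using Suc.prems J' by (intro feas_prob_Un[OF D]) auto
  moreover have "J' \<union> (J - J') = J" using J' by auto
  ultimately show ?case
    using mult_mono[of "feas_prob D J' \<theta>" q "feas_prob D (J - J') \<theta>" "q ^ k"] by simp
qed

text \<open>The left side peaks at \<open>k = 1\<close>, with equality; from there on successive
  ratios are less than 1.\<close>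

lemma Suc_mult_power_le: "real (Suc k) * (11 / 20) ^ k \<le> ((11 / 10) :: real)"
proof (induction k)
  case (Suc k)
  show ?case
  proof (cases "k = 0")
    case False
    have "real (Suc (Suc k)) * (11 / 20) \<le> real (Suc k)" using False by simp
    then have "real (Suc (Suc k)) * (11 / 20) * (11 / 20) ^ k \<le> real (Suc k) * (11 / 20) ^ k"
      by (intro mult_right_mono) auto
    then have "real (Suc (Suc k)) * (11 / 20) ^ Suc k \<le> real (Suc k) * (11 / 20) ^ k"
      by (simp only: power_Suc mult.assoc)
    then show ?thesis using Suc by (rule order_trans)
  qed simp
qed simp

lemma feas_prob_window_bound:
  fixes D :: "(real^'d) set"
  assumes D: "finite D" "D \<subseteq> sphere 0 1" and d: "2 \<le> CARD('d)"
    and e: "0 < e" "10 * real CARD('d) ^ 2 * e \<le> 1"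
  shows "feas_prob D {..<n} (\<lambda>_. - e) \<le> feas_prob D {..<n} (\<lambda>_. e) + 10 * real CARD('d) ^ 2 * e"
proof -
  define s where "s = sqrt (real CARD('d))"
  have s2: "real CARD('d) = s * s" by (simp add: s_def)
  have s_ge: "(141 / 100) \<le> s" unfolding s_def
    using d by (intro real_le_rsqrt) (simp add: power2_eq_square)
  have s0: "0 < s" using s_ge by simp
  have e4: "10 * (s * s * s * s) * e \<le> 1" using e(2) by (simp add: s2 power2_eq_square mult_ac)
  have se: "s * s * s * e * (141 / 10) \<le> 1"
  proof -
    have "s * s * s * e * (141 / 10) = 10 * ((141 / 100) * (s * s * s)) * e" by simp
    also have "\<dots> \<le> 10 * (s * (s * s * s)) * e"
      using s_ge e s0 by (intro mult_right_mono mult_left_mono) auto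
    finally show ?thesis using e4 by (simp add: mult_ac)
  qed
  \<comment> \<open>This is the width condition of the slab bound for the window from
    \<open>- e\<close> to \<open>e\<close>.\<close>
  have se1: "s * e \<le> 1 / 10"
  proof -
    have "1 * (s * e) \<le> (s * s) * (s * e)"
      using s_ge s0 e mult_mono[of "141 / 100" s "141 / 100" s] by (intro mult_right_mono) auto
    then show ?thesis using se by (simp add: mult_ac)
  qed
  \<comment> \<open>Telescoping from \<open>- e\<close> to 0 with the trivial \<open>q = 1\<close>
    costs at most \<open>5.5 * s ^ 3 * e\<close>, which is less than 0.391. At threshold 0 the
    probability is at most \<open>(3125 / 8192) ^ 2\<close>, less than 0.146. The sum stays under
    0.55.\<close>
  have block: "feas_prob D J (\<lambda>_. - e) \<le> (11 / 20)" if J: "finite J" "card J = 5 * CARD('d)" for J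
  proof -
    have "feas_prob D J (\<lambda>_. - e) \<le> feas_prob D J (\<lambda>_. 0) + real (card J) * ((11 / 10) * s * (0 - - e) * 1)"
      unfolding s_def using e se1 d by (intro feas_prob_telescope D J feas_prob_le_1) (auto simp: s_def mult.commute)
    moreover have "feas_prob D J (\<lambda>_. 0) \<le> real (\<Sum>k\<le>CARD('d). card J choose k) / 2 ^ card J"
      using D J by (intro feas_prob_zero_le countable_finite)
    moreover have "\<dots> \<le> (4 * (5 / 4) ^ 5) ^ CARD('d) / 2 ^ card J"
      unfolding J(2) by (intro divide_right_mono sum_binomial_lower_tail) auto
    moreover have "\<dots> = (3125 / 8192) ^ CARD('d)"
      unfolding J(2) power_mult power_divide[symmetric] by (simp add: power_divide)
    moreover have "\<dots> \<le> (3125 / 8192) ^ 2"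
      using d by (intro power_decreasing) auto
    moreover have "real (card J) * ((11 / 10) * s * (0 - - e) * 1) = (11 / 2) * (s * s * s * e)"
      by (simp add: J(2) s2)
    moreover have "(3125 / 8192) ^ 2 \<le> (1456 / 10000 :: real)" by (simp add: power2_eq_square)
    ultimately show ?thesis using se by linarith
  qed
  define N where "N = 5 * CARD('d)"
  \<comment> \<open>One row is singled out in the telescoping, so blocks are taken from the other
    \<open>n - 1\<close> rows; \<open>n\<close> itself fits into \<open>k + 1\<close>
    blocks.\<close>
  define k where "k = (n - 1) div N"
  have N: "0 < N" using d by (simp add: N_def)
  have "n \<le> Suc k * N"
    using dividend_less_times_div[OF N, of "n - 1"] by (simp add: k_def mult.commute)
  have card: "k * N \<le> card ({..<n} - {i})" if "i < n" for i
    using that by (simp add: k_def)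
  have "feas_prob D {..<n} (\<lambda>_. - e) \<le>
      feas_prob D {..<n} (\<lambda>_. e) + real (card {..<n}) * ((11 / 10) * s * (e - - e) * (11 / 20) ^ k)"
    unfolding s_def
  proof (rule feas_prob_telescope[OF D])
    fix i assume "i \<in> {..<n}"
    then show "feas_prob D ({..<n} - {i}) (\<lambda>_. - e) \<le> (11 / 20) ^ k"
      using D card block by (intro feas_prob_blocks[where N = N]) (auto simp: countable_finite N_def)
  qed (use e d se1 in \<open>auto simp: s_def mult.commute\<close>)
  also have "real (card {..<n}) * ((11 / 10) * s * (e - - e) * (11 / 20) ^ k) = real n * ((11 / 5) * s * e * (11 / 20) ^ k)"
    by simp
  also have "\<dots> \<le> real (Suc k * N) * ((11 / 5) * s * e * (11 / 20) ^ k)"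
    using \<open>n \<le> Suc k * N\<close> s0 e by (intro mult_right_mono) (auto simp del: of_nat_mult mult_Suc)
  also have "\<dots> = real N * (11 / 5) * s * e * (real (Suc k) * (11 / 20) ^ k)" by (simp only: of_nat_mult mult_ac)
  also have "\<dots> \<le> real N * (11 / 5) * s * e * (11 / 10)"
    using s0 e by (intro mult_left_mono Suc_mult_power_le) auto
  also have "\<dots> = (121 / 10) * (s * s * s * e)" by (simp add: N_def s2)
  \<comment> \<open>The constant 12.1 is absorbed by \<open>10 * s\<close>, as
    \<open>s \<ge> 1.41\<close>; this raises the order from \<open>s ^ 3\<close> to the square of
    the dimension.\<close>
  also have "\<dots> \<le> 10 * s * (s * s * s * e)"
    using s_ge s0 e by (intro mult_right_mono) auto
  also have "\<dots> = 10 * real CARD('d) ^ 2 * e" by (simp add: s2 power2_eq_square mult_ac)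
  finally show ?thesis by simp
qed

section \<open>The tail of the condition number\<close>

text \<open>Exhaust \<open>D\<close> by finite subsets: the left side converges by continuity from
  below, and feasibility at \<open>e\<close> only grows with \<open>D\<close>.\<close>

lemma feas_prob_window_bound_countable:
  fixes D :: "(real^'d) set"
  assumes D: "countable D" "D \<subseteq> sphere 0 1" and d: "2 \<le> CARD('d)"
    and e: "0 < e" "10 * real CARD('d) ^ 2 * e \<le> 1"
  shows "feas_prob D {..<n} (\<lambda>_. - e) \<le> feas_prob D {..<n} (\<lambda>_. e) + 10 * real CARD('d) ^ 2 * e"
proof (cases "D = {}")
  case True
  then show ?thesis using e by (simp add: feas_prob_def feasible_set_def)
next
  case False
  define Dk where "Dk k = from_nat_into D ` {..k}" for k
  have Dk: "finite (Dk k)" "Dk k \<subseteq> D" for k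
    using from_nat_into[OF False] by (auto simp: Dk_def)
  have union: "(\<Union>k. Dk k) = D"
  proof -
    have "x \<in> (\<Union>k. Dk k)" if x: "x \<in> D" for x
    proof -
      obtain k where "from_nat_into D k = x" using from_nat_into_surj[OF D(1) x] by blast
      then show ?thesis by (intro UN_I[of k]) (auto simp: Dk_def)
    qed
    then show ?thesis using Dk(2) by blast
  qed
  have inc: "incseq Dk" unfolding Dk_def by (intro incseq_SucI image_mono) auto
  have "(\<lambda>k. measure (\<Pi>\<^sub>M i\<in>{..<n}. uniform_sphere) (feasible_set (Dk k) {..<n} (\<lambda>_. - e)))
      \<longlonglongrightarrow> measure (\<Pi>\<^sub>M i\<in>{..<n}. uniform_sphere) (\<Union>k. feasible_set (Dk k) {..<n} (\<lambda>_. - e))"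
  proof (rule finite_measure.finite_Lim_measure_incseq)
    show "finite_measure (\<Pi>\<^sub>M i\<in>{..<n}. (uniform_sphere :: (real^'d) measure))"
      by (rule prob_space.finite_measure) (rule prob_space_PiM_uniform_sphere)
    show "range (\<lambda>k. feasible_set (Dk k) {..<n} (\<lambda>_. - e)) \<subseteq> sets (\<Pi>\<^sub>M i\<in>{..<n}. uniform_sphere)"
      using Dk by (auto intro!: sets_feasible_set countable_finite)
    show "incseq (\<lambda>k. feasible_set (Dk k) {..<n} (\<lambda>_. - e))"
      unfolding feasible_set_def using incseqD[OF inc] by (intro monoI) blast
  qed
  moreover have "(\<Union>k. feasible_set (Dk k) {..<n} (\<lambda>_. - e)) = feasible_set D {..<n} (\<lambda>_. - e)"
    unfolding union[symmetric] by (auto simp: feasible_set_def)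
  ultimately have lim: "(\<lambda>k. feas_prob (Dk k) {..<n} (\<lambda>_. - e)) \<longlonglongrightarrow> feas_prob D {..<n} (\<lambda>_. - e)"
    by (simp add: feas_prob_def)
  show ?thesis
  proof (rule LIMSEQ_le_const2[OF lim], intro exI allI impI)
    fix k
    have "feas_prob (Dk k) {..<n} (\<lambda>_. - e) \<le> feas_prob (Dk k) {..<n} (\<lambda>_. e) + 10 * real CARD('d) ^ 2 * e"
      using Dk[of k] D(2) by (intro feas_prob_window_bound d e) auto
    moreover have "feas_prob (Dk k) {..<n} (\<lambda>_. e) \<le> feas_prob D {..<n} (\<lambda>_. e)"
      using Dk[of k] D(1) by (intro feas_prob_mono) auto
    ultimately show "feas_prob (Dk k) {..<n} (\<lambda>_. - e) \<le> feas_prob D {..<n} (\<lambda>_. e) + 10 * real CARD('d) ^ 2 * e"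
      by linarith
  qed
qed

lemma rows_on_sphere:
  assumes "A \<in> space (uniform_points n :: (nat \<Rightarrow> real^'d) measure)" "i < n"
  shows "A i \<in> sphere 0 1"
  using assms by (auto simp only: space_uniform_points lessThan_iff elim: PiE_mem)

text \<open>Finitely many strict inequalities define an open set of centres, so a dense
  \<open>D\<close> meets it whenever the sphere does. This expresses feasibility through the cap
  radius.\<close>

lemma feasible_set_dense:
  fixes D :: "(real^'d) set"
  assumes D: "D \<subseteq> sphere 0 1" "sphere 0 1 \<subseteq> closure D" and t: "-1 \<le> t" "t < 1"
  shows "feasible_set D {..<n} (\<lambda>_. t) = {A \<in> space (uniform_points n). sic_radius n A < arccos t}"
proof -
  have "(\<exists>p\<in>D. \<forall>i\<in>{..<n}. t < p \<bullet> A i) \<longleftrightarrow> sic_radius n A < arccos t"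
    if A: "A \<in> space (uniform_points n)" for A :: "nat \<Rightarrow> real^'d"
  proof -
    have "arccos 1 < arccos t" using t by (intro arccos_less_arccos) auto
    then have "sic_radius n A < arccos t \<longleftrightarrow> (\<exists>p\<in>sphere 0 1. \<forall>i<n. t < p \<bullet> A i)"
      using sic_radius_less_iff[of n A "arccos t", OF rows_on_sphere[OF A]] t
      by (simp add: arccos_ubound)
    also have "\<dots> \<longleftrightarrow> (\<exists>p\<in>D. \<forall>i\<in>{..<n}. t < p \<bullet> A i)"
    proof
      assume "\<exists>p\<in>sphere 0 1. \<forall>i<n. t < p \<bullet> A i"
      then obtain p where p: "p \<in> sphere 0 1" "\<forall>i<n. t < p \<bullet> A i" by blast
      define U where "U = (\<Inter>i\<in>{..<n}. {q. t < q \<bullet> A i})"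
      have "open U"
        unfolding U_def by (intro open_INT ballI open_Collect_less continuous_intros) auto
      moreover have "p \<in> U" "p \<in> closure D" using p D by (auto simp: U_def)
      ultimately have "U \<inter> D \<noteq> {}" using open_Int_closure_eq_empty[of U D] by blast
      then show "\<exists>p\<in>D. \<forall>i\<in>{..<n}. t < p \<bullet> A i" by (auto simp: U_def)
    qed (use D in blast)
    finally show ?thesis by blast
  qed
  then show ?thesis unfolding feasible_set_def uniform_points_def[symmetric] by blast
qed

text \<open>As \<open>arccos\<close> is decreasing, the event lies in the difference of the nested
  feasibility events at \<open>- e\<close> and \<open>e\<close>, whose probabilities differ by at
  most the window bound.\<close>

lemma abs_cos_sic_radius_tail:
  assumes d: "2 \<le> CARD('d)" and e: "0 < e" "10 * real CARD('d) ^ 2 * e \<le> 1"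
  shows "measure (uniform_points n :: (nat \<Rightarrow> real^'d) measure)
      {A \<in> space (uniform_points n). \<bar>cos (sic_radius n A)\<bar> < e} \<le> 10 * real CARD('d) ^ 2 * e"
proof -
  let ?M = "uniform_points n :: (nat \<Rightarrow> real^'d) measure"
  interpret prob_space ?M by (rule prob_space_uniform_points)
  obtain D where D: "countable D" "D \<subseteq> sphere (0::real^'d) 1" "sphere 0 1 \<subseteq> closure D"
    using separable[of "sphere (0::real^'d) 1"] by blast
  have "4 \<le> real CARD('d) ^ 2" using d power_mono[of 2 "real CARD('d)" 2] by simp
  then have "4 * (10 * e) \<le> real CARD('d) ^ 2 * (10 * e)"
    using e(1) by (intro mult_right_mono) auto
  then have e1: "e < 1" using e by linarith
  define F where "F t = feasible_set D {..<n} (\<lambda>_. t)" for t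
  have F: "F t = {A \<in> space ?M. sic_radius n A < arccos t}" if "-1 \<le> t" "t < 1" for t
    unfolding F_def by (rule feasible_set_dense[OF D(2,3) that])
  have F_sets [measurable]: "F t \<in> sets ?M" for t
    unfolding F_def uniform_points_def by (intro sets_feasible_set D) auto
  have "{A \<in> space ?M. \<bar>cos (sic_radius n A)\<bar> < e} \<subseteq> F (- e) - F e"
  proof
    fix A assume "A \<in> {A \<in> space ?M. \<bar>cos (sic_radius n A)\<bar> < e}"
    then have A: "A \<in> space ?M" and c: "\<bar>cos (sic_radius n A)\<bar> < e" by auto
    have "sic_radius n A \<in> {0..pi}"
      using smallest_including_cap_sic_radius[of n A, OF rows_on_sphere[OF A]]
      unfolding smallest_including_cap_def including_cap_def by blast
    then have r: "arccos (cos (sic_radius n A)) = sic_radius n A" by (simp add: arccos_cos)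
    have "arccos (cos (sic_radius n A)) < arccos (- e)" "arccos e < arccos (cos (sic_radius n A))"
      using c e1 by (intro arccos_less_arccos; simp)+
    then show "A \<in> F (- e) - F e"
      using A e(1) e1 by (simp add: F r)
  qed
  then have "measure ?M {A \<in> space ?M. \<bar>cos (sic_radius n A)\<bar> < e} \<le> measure ?M (F (- e) - F e)"
    by (intro finite_measure_mono) auto
  also have "\<dots> = measure ?M (F (- e)) - measure ?M (F e)"
  proof (rule finite_measure_Diff)
    show "F e \<subseteq> F (- e)"
    proof -
      have "- e < x" if "e < x" for x using that e(1) by linarith
      then show ?thesis unfolding F_def feasible_set_def by blast
    qed
  qed auto
  also have "\<dots> \<le> 10 * real CARD('d) ^ 2 * e"
    using feas_prob_window_bound_countable[OF D(1,2) d e, of n]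
    by (simp add: F_def feas_prob_def uniform_points_def)
  finally show ?thesis .
qed

section \<open>From the tail bound to the expectation\<close>

lemma e2ennreal_ln_ext_gcc_cond_gt:
  assumes "0 \<le> s" "ennreal s < e2ennreal (ln_ext (gcc_cond n A))"
  shows "\<bar>cos (sic_radius n A)\<bar> < exp (- s)"
proof (cases "cos (sic_radius n A) = 0")
  case False
  then have c: "0 < \<bar>cos (sic_radius n A)\<bar>" by simp
  have "e2ennreal (ln_ext (gcc_cond n A)) = ennreal (- ln \<bar>cos (sic_radius n A)\<bar>)"
    using False by (simp add: gcc_cond_def ln_ext_def ln_div e2ennreal_ereal)
  then have "s < - ln \<bar>cos (sic_radius n A)\<bar>"
    using assms by (simp add: ennreal_less_iff)
  then have "ln \<bar>cos (sic_radius n A)\<bar> < - s" by simp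
  then have "exp (ln \<bar>cos (sic_radius n A)\<bar>) < exp (- s)" by (simp only: exp_less_cancel_iff)
  then show ?thesis using c by simp
qed simp

text \<open>The pointwise layer-cake formula, valid also at infinity.\<close>

lemma ennreal_eq_nn_integral_indicator:
  "(\<integral>\<^sup>+s. indicator {s. 0 \<le> s \<and> ennreal s < x} s \<partial>lborel) = x"
proof (cases x)
  case (real r)
  then have "{s. 0 \<le> s \<and> ennreal s < x} = {0..<r}" by (auto simp: ennreal_less_iff)
  then show ?thesis using real by simp
next
  case top
  then have "{s. 0 \<le> s \<and> ennreal s < x} = {0..}" by auto
  moreover have "emeasure lborel {0::real..} = \<infinity>"
  proof (rule ccontr)
    assume "emeasure lborel {0::real..} \<noteq> \<infinity>"
    then obtain r where r: "0 \<le> r" "emeasure lborel {0::real..} = ennreal r"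
      by (cases "emeasure lborel {0::real..}") auto
    have "emeasure lborel {0..r + 1} \<le> emeasure lborel {0::real..}" by (intro emeasure_mono) auto
    then show False using r by simp
  qed
  ultimately show ?thesis using top by simp
qed

text \<open>Integrate the tail probabilities: up to \<open>L\<close> they are at most 1 and
  contribute \<open>L\<close>; beyond \<open>L\<close> the exponential bound integrates to
  1.\<close>

lemma nn_integral_le_of_exp_tail:
  fixes X :: "'a \<Rightarrow> ennreal"
  assumes M: "prob_space M" and X [measurable]: "X \<in> borel_measurable M" and L: "0 \<le> L"
    and tail: "\<And>s. L < s \<Longrightarrow> emeasure M {x \<in> space M. ennreal s < X x} \<le> ennreal (exp (L - s))"
  shows "(\<integral>\<^sup>+x. X x \<partial>M) \<le> ennreal (L + 1)"
proof -
  interpret prob_space M by fact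
  interpret pair_sigma_finite M lborel ..
  have "(\<integral>\<^sup>+x. X x \<partial>M) = (\<integral>\<^sup>+x. \<integral>\<^sup>+s. indicator {s. 0 \<le> s \<and> ennreal s < X x} s \<partial>lborel \<partial>M)"
    by (simp only: ennreal_eq_nn_integral_indicator)
  also have "\<dots> = (\<integral>\<^sup>+x. \<integral>\<^sup>+s. indicator {0..} s * indicator {y. ennreal s < X y} x \<partial>lborel \<partial>M)"
    by (intro nn_integral_cong) (auto simp: indicator_def)
  also have "\<dots> = (\<integral>\<^sup>+s. \<integral>\<^sup>+x. indicator {0..} s * indicator {y. ennreal s < X y} x \<partial>M \<partial>lborel)"
    by (rule Fubini'[symmetric, where f = "\<lambda>x s. indicator {0..} s * indicator {y. ennreal s < X y} x"]) measurable
  also have "\<dots> \<le> (\<integral>\<^sup>+s. indicator {0..L} s + ennreal (exp (L - s)) * indicator {L..} s \<partial>lborel)"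
  proof (rule nn_integral_mono)
    fix s :: real
    have "(\<integral>\<^sup>+x. indicator {0..} s * indicator {y. ennreal s < X y} x \<partial>M) =
        indicator {0..} s * emeasure M {x \<in> space M. ennreal s < X x}"
    proof -
      have "(\<integral>\<^sup>+x. indicator {y. ennreal s < X y} x \<partial>M) =
          (\<integral>\<^sup>+x. indicator {x \<in> space M. ennreal s < X x} x \<partial>M)"
        by (intro nn_integral_cong) (auto simp: indicator_def)
      also have "\<dots> = emeasure M {x \<in> space M. ennreal s < X x}"
        by (intro nn_integral_indicator) measurable
      finally show ?thesis by (cases "0 \<le> s") simp_all
    qed
    also have "\<dots> \<le> indicator {0..L} s + ennreal (exp (L - s)) * indicator {L..} s"
      using tail[of s] measure_le_1[of "{x \<in> space M. ennreal s < X x}"] L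
      by (cases "s < 0"; cases "s \<le> L") (auto simp: indicator_def add_increasing2)
    finally show "(\<integral>\<^sup>+x. indicator {0..} s * indicator {y. ennreal s < X y} x \<partial>M)
        \<le> indicator {0..L} s + ennreal (exp (L - s)) * indicator {L..} s" .
  qed
  also have "\<dots> = ennreal L + (\<integral>\<^sup>+s. ennreal (exp (L - s)) * indicator {L..} s \<partial>lborel)"
    using L by (subst nn_integral_add) auto
  also have "(\<integral>\<^sup>+s. ennreal (exp (L - s)) * indicator {L..} s \<partial>lborel) = ennreal (0 - (- exp (L - L)))"
  proof (rule nn_integral_FTC_atLeast[where F = "\<lambda>s. - exp (L - s)"])
    show "((\<lambda>s. - exp (L - s)) \<longlongrightarrow> 0) at_top" by real_asymp
  qed (auto intro!: derivative_eq_intros)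
  finally show ?thesis using L by (simp add: ennreal_plus)
qed

lemma ln_10_le: "ln 10 \<le> (2.31 :: real)"
proof -
  \<comment> \<open>Since \<open>2.31 = 20 * 0.1155\<close>, it suffices to take the 20th power of
    the quadratic Taylor lower bound for \<open>exp\<close> at 0.1155.\<close>
  define x :: real where "x = 1 + 1155 / 10000 + (1155 / 10000)\<^sup>2 / 2"
  have "10 \<le> x ^ 20" by (simp add: x_def power_numeral_reduce field_simps)
  also have "x ^ 20 \<le> exp (1155 / 10000) ^ 20"
    unfolding x_def by (intro power_mono exp_lower_Taylor_quadratic) auto
  also have "\<dots> = exp (2.31)" by (simp flip: exp_of_nat_mult)
  finally show ?thesis by (metis ln_exp ln_mono zero_less_numeral)
qed

theorem theorem1p4:
  fixes m n :: nat
  assumes "1 \<le> m" and "m < n" and "CARD('d::finite) = m + 1"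
  shows "(\<integral>\<^sup>+ A. e2ennreal (ln_ext (gcc_cond n A)) \<partial>(uniform_points n :: (nat \<Rightarrow> real^'d) measure))
           \<le> ennreal (2 * ln (real (m + 1)) + 3.31)"
proof -
  let ?M = "uniform_points n :: (nat \<Rightarrow> real^'d) measure"
  \<comment> \<open>The tail bound reads \<open>K * e\<close>; at \<open>e = exp (- s)\<close> it
    becomes \<open>exp (ln K - s)\<close>, and \<open>s > ln K\<close> makes it less than 1.\<close>
  define K where "K = 10 * real CARD('d) ^ 2"
  have d: "2 \<le> CARD('d)" using assms by simp
  have K: "1 \<le> K" unfolding K_def using d one_le_power[of "real CARD('d)" 2] by linarith
  have "(\<integral>\<^sup>+ A. e2ennreal (ln_ext (gcc_cond n A)) \<partial>?M) \<le> ennreal (ln K + 1)"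
  proof (rule nn_integral_le_of_exp_tail[OF prob_space_uniform_points])
    show "(\<lambda>A. e2ennreal (ln_ext (gcc_cond n A))) \<in> borel_measurable ?M"
      by (intro measurable_compose[OF measurable_ln_ext_gcc_cond]) measurable
    show "0 \<le> ln K" using K by simp
    fix s assume s: "ln K < s"
    then have "0 \<le> s" using \<open>0 \<le> ln K\<close> by linarith
    have Ks: "K * exp (- s) = exp (ln K - s)" using K by (simp add: exp_diff exp_minus field_simps)
    interpret prob_space ?M by (rule prob_space_uniform_points)
    have "emeasure ?M {A \<in> space ?M. ennreal s < e2ennreal (ln_ext (gcc_cond n A))} \<le>
        emeasure ?M {A \<in> space ?M. \<bar>cos (sic_radius n A)\<bar> < exp (- s)}"
      using e2ennreal_ln_ext_gcc_cond_gt[OF \<open>0 \<le> s\<close>] by (intro emeasure_mono) auto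
    also have "\<dots> \<le> ennreal (K * exp (- s))"
    proof -
      have "K * exp (- s) \<le> 1" using s by (simp add: Ks)
      then show ?thesis
        unfolding emeasure_eq_measure K_def by (intro ennreal_leI abs_cos_sic_radius_tail d) auto
    qed
    also have "K * exp (- s) = exp (ln K - s)" by (rule Ks)
    finally show "emeasure ?M {A \<in> space ?M. ennreal s < e2ennreal (ln_ext (gcc_cond n A))}
        \<le> ennreal (exp (ln K - s))" .
  qed
  also have "ln K = ln 10 + 2 * ln (real (m + 1))"
    using assms(3) by (simp add: K_def ln_mult ln_realpow)
  \<comment> \<open>The constant 3.31 is 2.31, for \<open>ln 10\<close>, plus 1 from the exponential
    tail.\<close>
  also have "ennreal (ln 10 + 2 * ln (real (m + 1)) + 1) \<le> ennreal (2 * ln (real (m + 1)) + 3.31)"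
    using ln_10_le by (intro ennreal_leI) simp
  finally show ?thesis .
qed

end
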